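(* Let $f\in \mathrm{Emb}(\mathbb{R}^2)$ be dissipative with symmetry group $\Gamma$ such that $\kappa\in\Gamma$, and suppose $\mathrm{Fix}(f)=\{0\}$. Suppose in addition that one of the following holds: a) $f\in \mathrm{Emb}^{+}(\mathbb{R}^2)$ and $f$ does not interchange the connected components of $\mathbb{R}^2\setminus \mathrm{Fix}\langle\kappa\rangle$; b) there exist no $2$-periodic orbits of $f$. Then $0$ is a global attractor for $f$.
   Context: $\mathrm{Emb}(\mathbb{R}^2)$ is the set of continuous injective maps $f:\mathbb{R}^2\to\mathbb{R}^2$ (not necessarily onto), and $\mathrm{Emb}^+(\mathbb{R}^2)$ is the subset of orientation preserving ones. $\mathrm{Fix}(f)$ is the set of fixed points of $f$. A $2$-periodic orbit is the orbit of a point $p$ with $f^2(p)=p\neq f(p)$. An element $\gamma\in GL(2)$ is a symmetry of $f$ if $f(\gamma x)=\gamma f(x)$ for all $x\in\mathbb{R}^2$. The symmetry group of $f$ is the smallest closed subgroup of $GL(2)$ containing all symmetries of $f$; it is denoted $\Gamma$ and assumed to be a compact Lie group. $\kappa$ is the flip $\kappa(x,y)=(x,-y)$, and $\mathrm{Fix}\langle\kappa\rangle=\{p\in\mathbb{R}^2:\kappa p=p\}$ is the horizontal axis. "$f$ does not interchange the connected components of $\mathbb{R}^2\setminus\mathrm{Fix}\langle\kappa\rangle$" means that $f$ maps each of the two open half-planes into itself. $\omega(p)$ is the set of points $q$ for which there is a sequence $n_j\to+\infty$ with $f^{n_j}(p)\to q$. We write $\omega(p)=\infty$ if $\|f^n(p)\|\to\infty$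 as $n\to\infty$. The map $f$ is dissipative if there is an open set $V\subset\mathbb{R}^2$ such that $\mathbb{R}^2\setminus V$ is compact and, for all $p\in\mathbb{R}^2$, $\omega(p)\cap V=\emptyset$ and $\omega(p)\neq\infty$. The point $0\in\mathrm{Fix}(f)$ is a global attractor if $\omega(p)=\{0\}$ for every $p\in\mathbb{R}^2$. *)

theory Defs
  imports "HOL-Complex_Analysis.Winding_Numbers" "HOL-Algebra.Group"
begin

subsection \<open>Planar embeddings\<close>

type_synonym plane = "real^2"

definition Emb :: "(plane \<Rightarrow> plane) set" where
  "Emb = {f. continuous_on UNIV f \<and> inj f}"

definition plane_to_complex :: "plane \<Rightarrow> complex" where
  "plane_to_complex v = Complex (v $ 1) (v $ 2)"

definition complex_to_plane :: "complex \<Rightarrow> plane" where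
  "complex_to_plane z = vector [Re z, Im z]"

text \<open>
  Elements of \<open>Emb\<close> are merely continuous, so orientation is expressed by the local degree: the
  image of every positively oriented circle winds exactly once, in the positive direction, around
  the image of its centre. For an element of \<open>Emb\<close> this number is \<open>1\<close> for all circles or
  \<open>-1\<close> for all circles.
\<close>

definition orientation_preserving :: "(plane \<Rightarrow> plane) \<Rightarrow> bool" where
  "orientation_preserving f \<longleftrightarrow>
     (\<forall>p. \<forall>r>0. winding_number
        (plane_to_complex \<circ> f \<circ> complex_to_plane \<circ> circlepath (plane_to_complex p) r)
        (plane_to_complex (f p)) = 1)"

definition Emb_plus :: "(plane \<Rightarrow> plane) set" where
  "Emb_plus = {f \<in> Emb. orientation_preserving f}"

subsection \<open>Symmetries\<close>

definition GL2 :: "(real^2^2) monoid" where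
  "GL2 = \<lparr>carrier = {A. invertible A}, mult = (**), one = mat 1\<rparr>"

lemma group_GL2: "group GL2"
proof (rule groupI)
  fix A assume "A \<in> carrier GL2"
  then obtain B where "A ** B = mat 1" "B ** A = mat 1"
    by (auto simp: GL2_def invertible_def)
  then show "\<exists>B\<in>carrier GL2. B \<otimes>\<^bsub>GL2\<^esub> A = \<one>\<^bsub>GL2\<^esub>"
    by (auto simp: GL2_def invertible_def)
next
  show "\<one>\<^bsub>GL2\<^esub> \<in> carrier GL2"
    unfolding GL2_def invertible_def by (auto intro: exI[of _ "mat 1"])
qed (auto simp: GL2_def invertible_mult matrix_mul_assoc)

definition symmetries :: "(plane \<Rightarrow> plane) \<Rightarrow> (real^2^2) set" where
  "symmetries f = {\<gamma> \<in> carrier GL2. \<forall>x. f (\<gamma> *v x) = \<gamma> *v f x}"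

text \<open>Closedness is relative to the general linear group, not to the space of all matrices.\<close>

definition symmetry_group :: "(plane \<Rightarrow> plane) \<Rightarrow> (real^2^2) set" where
  "symmetry_group f =
     \<Inter> {H. subgroup H GL2 \<and> closedin (top_of_set (carrier GL2)) H \<and> symmetries f \<subseteq> H}"

definition flip :: "real^2^2" where
  "flip = vector [vector [1, 0], vector [0, -1]]"

subsection \<open>Dynamics\<close>

definition fixed_points :: "(plane \<Rightarrow> plane) \<Rightarrow> plane set" where
  "fixed_points f = {p. f p = p}"

definition two_periodic_orbit :: "(plane \<Rightarrow> plane) \<Rightarrow> plane set \<Rightarrow> bool" where
  "two_periodic_orbit f Q \<longleftrightarrow>
     (\<exists>p. (f ^^ 2) p = p \<and> f p \<noteq> p \<and> Q = range (\<lambda>n. (f ^^ n) p))"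

definition omega_limit :: "(plane \<Rightarrow> plane) \<Rightarrow> plane \<Rightarrow> plane set" where
  "omega_limit f p =
     {q. \<exists>n :: nat \<Rightarrow> nat. filterlim n at_top sequentially \<and> (\<lambda>j. (f ^^ n j) p) \<longlonglongrightarrow> q}"

definition omega_is_infinity :: "(plane \<Rightarrow> plane) \<Rightarrow> plane \<Rightarrow> bool" where
  "omega_is_infinity f p \<longleftrightarrow> filterlim (\<lambda>n. norm ((f ^^ n) p)) at_top sequentially"

definition dissipative :: "(plane \<Rightarrow> plane) \<Rightarrow> bool" where
  "dissipative f \<longleftrightarrow>
     (\<exists>V. open V \<and> compact (UNIV - V) \<and>
        (\<forall>p. omega_limit f p \<inter> V = {} \<and> \<not> omega_is_infinity f p))"

definition zero_global_attractor :: "(plane \<Rightarrow> plane) \<Rightarrow> bool" where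
  "zero_global_attractor f \<longleftrightarrow> 0 \<in> fixed_points f \<and> (\<forall>p. omega_limit f p = {0})"

text \<open>
  The connected components of the complement of the horizontal axis are the two open half-planes.
\<close>

definition not_interchanging_components :: "(plane \<Rightarrow> plane) \<Rightarrow> bool" where
  "not_interchanging_components f \<longleftrightarrow>
     (\<forall>C \<in> components (UNIV - fixed_points ((*v) flip)). f ` C \<subseteq> C)"

end

theory Submission
  imports Defs "HOL-Complex_Analysis.Riemann_Mapping"
begin

text \<open>
  Under either hypothesis some map \<open>g\<close>, equal to \<open>f\<close> or to \<open>f \<circ> f\<close>, preserves orientation, maps the upper
  half-plane into itself and has \<open>0\<close> as its only fixed point. In the upper half-plane, which is itself a
  plane, \<open>g\<close> then has no fixed point, and Brouwer's theory says that such a map has no recurrence: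
  no orbit accumulates there. By symmetry no orbit accumulates in the lower half-plane either, so
  every limit point lies on the axis. Dissipation makes orbits bounded, hence limit points exist. On the
  axis \<open>g\<close> is increasing, with bounded orbits and only the fixed point \<open>0\<close>, so it moves every other point
  towards \<open>0\<close>; since each limit point of an orbit has a preimage among the limit points of the same
  orbit, \<open>0\<close> is the only one.

  The work lies in Brouwer's theorem that an orientation preserving embedding of the plane
  without fixed points has no periodic point, and hence no free connected open set returns to itself.
  It has two parts.

  \<^item> Period two is excluded by comparing angles (\<open>degree_one_no_two_cycle\<close>). Write \<open>W(x)\<close> for a
    continuous logarithm of \<open>f x - x\<close>. The step from \<open>W(x)\<close> to \<open>W(f x)\<close> is, up to a
    constant, the turning of the chord from \<open>x\<close> to \<open>f x\<close> under \<open>f\<close>; this turning is symmetric in the two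
    end points, whereas on a cycle of length two the two steps are opposite and nonzero.

  \<^item> A period \<open>k \<ge> 3\<close> is reduced to a smaller one (\<open>brouwer_map_no_cycle_step\<close>) by composing the map
    with homeomorphisms that push a point inside a connected open set disjoint from its image. Such
    a push creates no fixed point (\<open>brouwer_map_push\<close>). Two pushes, one inside a ball that is as large as
    possible among the balls around a periodic point disjoint from their images and one along an arc
    through the point where that ball touches its image, cut one step out of the cycle.

  Orientation enters only as degree one of the map, and the degree is defined for an injective
  map by a single continuous logarithm, which makes it multiplicative under composition.
\<close>

section \<open>The degree of an injective map of the plane\<close>

text \<open>
  Pairs of distinct points are parametrised as \<open>(x, x + exp w)\<close>; the parameters form a simply
  connected space, so the difference of the values of an injective map has a continuous logarithm \<open>M\<close>.
  Adding \<open>2 * pi * \<i>\<close> to \<open>w\<close> moves the second point once around the first, and the resulting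
  increment of \<open>M\<close> counts the turns of the image of the second point around that of the first.
\<close>

definition has_degree :: "(complex \<Rightarrow> complex) \<Rightarrow> int \<Rightarrow> bool" where
  "has_degree f d \<longleftrightarrow>
     (\<exists>M. continuous_on UNIV M \<and>
        (\<forall>x w. f (x + exp w) - f x = exp (M (x, w)) \<and>
               M (x, w + 2 * pi * \<i>) = M (x, w) + 2 * pi * \<i> * d))"

text \<open>
  The difference of two logarithms of one function takes values in the discrete set of integer
  multiples of \<open>2 * pi * \<i>\<close>, so on a connected set it is constant. All the degree computations rest on this.
\<close>

lemma exp_lifts_differ_by_constant:
  fixes u v :: "'a::topological_space \<Rightarrow> complex"
  assumes "connected S" "continuous_on S u" "continuous_on S v"
    and eq: "\<And>x. x \<in> S \<Longrightarrow> exp (u x) = exp (v x)"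
  obtains k :: int where "\<forall>x\<in>S. u x = v x + 2 * pi * \<i> * k"
proof (cases "S = {}")
  case False
  then obtain a where a: "a \<in> S" by blast
  have int: "\<exists>n::int. u x - v x = 2 * pi * \<i> * n" if "x \<in> S" for x
    using eq [OF that] by (force simp: exp_eq algebra_simps)
  have "(\<lambda>x. u x - v x) constant_on S"
  proof (rule continuous_discrete_range_constant)
    show "connected S" "continuous_on S (\<lambda>x. u x - v x)"
      by (auto intro!: continuous_intros assms)
    fix x assume x: "x \<in> S"
    show "\<exists>e>0. \<forall>y. y \<in> S \<and> u y - v y \<noteq> u x - v x \<longrightarrow> e \<le> norm (u y - v y - (u x - v x))"
    proof (intro exI conjI allI impI)
      show "(0::real) < 1" by simp
      fix y assume y: "y \<in> S \<and> u y - v y \<noteq> u x - v x"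
      obtain n m :: int where nm: "u x - v x = 2 * pi * \<i> * n" "u y - v y = 2 * pi * \<i> * m"
        using int x y by metis
      have d: "u y - v y - (u x - v x) = 2 * pi * \<i> * of_int (m - n)"
        unfolding nm by (simp add: algebra_simps)
      have "m \<noteq> n" using y nm by auto
      then have "1 \<le> \<bar>real_of_int (m - n)\<bar>" by linarith
      then have "1 * 1 \<le> 2 * pi * \<bar>real_of_int (m - n)\<bar>"
        using pi_ge_two by (intro mult_mono) auto
      then show "1 \<le> norm (u y - v y - (u x - v x))"
        unfolding d by (simp add: norm_mult del: of_int_diff)
    qed
  qed
  then obtain c where c: "\<And>x. x \<in> S \<Longrightarrow> u x - v x = c"
    by (auto simp: constant_on_def)
  obtain k :: int where "u a - v a = 2 * pi * \<i> * k"
    using int a by metis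
  then show ?thesis
    using c a by (intro that [of k]) (metis add.commute diff_add_cancel)
qed (use that in auto)

lemma exp_plus_two_pi_i: "exp (w + complex_of_real (2 * pi) * \<i>) = exp w"
  unfolding exp_eq by (rule exI [of _ 1]) simp

lemma degree_exists:
  assumes cont: "continuous_on UNIV f" and inj: "inj f"
  obtains d where "has_degree f d"
proof -
  have c: "continuous_on UNIV (\<lambda>z. f (fst z + exp (snd z)) - f (fst z))"
    by (intro continuous_intros continuous_on_compose2 [OF cont]) auto
  have nz: "f (fst z + exp (snd z)) - f (fst z) \<noteq> 0" for z :: "complex \<times> complex"
    using inj by (simp add: inj_eq)
  obtain M where M: "continuous_on UNIV M"
      "\<And>z. f (fst z + exp (snd z)) - f (fst z) = exp (M z)"
    by (rule continuous_logarithm_on_contractible [OF c convex_imp_contractible [OF convex_UNIV] nz]) blast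
  have "continuous_on UNIV (\<lambda>z. M (fst z, snd z + 2 * pi * \<i>))"
    by (intro continuous_on_compose2 [OF M(1)] continuous_intros) auto
  moreover have "exp (M (fst z, snd z + 2 * pi * \<i>)) = exp (M z)" for z
    unfolding M(2) [symmetric] using exp_plus_two_pi_i by simp
  ultimately obtain k :: int
    where k: "\<forall>z\<in>UNIV. M (fst z, snd z + 2 * pi * \<i>) = M z + 2 * pi * \<i> * k"
    by (rule exp_lifts_differ_by_constant [OF connected_UNIV _ M(1)])
  have "has_degree f k"
    unfolding has_degree_def using M(1) M(2) [of "(x, w)" for x w] bspec [OF k, of "(x, w)" for x w]
    by (intro exI [of _ M]) simp
  then show ?thesis by (rule that)
qed

text \<open>
  A logarithm along one single circle determines the degree. This is how it is computed in
  every concrete case below.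
\<close>

lemma degree_from_circle:
  fixes N :: "real \<Rightarrow> complex"
  assumes "has_degree f d" and N: "continuous_on {0..2*pi} N"
    and eq: "\<And>s. s \<in> {0..2*pi} \<Longrightarrow> f (x + exp (w + \<i> * s)) - f x = exp (N s)"
  shows "N (2*pi) - N 0 = 2 * pi * \<i> * d"
proof -
  obtain M where M: "continuous_on UNIV M" "\<And>x w. f (x + exp w) - f x = exp (M (x, w))"
      "\<And>x w. M (x, w + 2 * pi * \<i>) = M (x, w) + 2 * pi * \<i> * d"
    using assms(1) unfolding has_degree_def by blast
  have "continuous_on {0..2*pi} (\<lambda>s. M (x, w + \<i> * s))"
    by (intro continuous_on_compose2 [OF M(1)] continuous_intros) auto
  moreover have "exp (N s) = exp (M (x, w + \<i> * s))" if "s \<in> {0..2*pi}" for s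
    using eq [OF that] M(2) by metis
  ultimately obtain k :: int where k: "\<forall>s\<in>{0..2*pi}. N s = M (x, w + \<i> * s) + 2 * pi * \<i> * k"
    by (rule exp_lifts_differ_by_constant [OF connected_Icc N])
  have "N (2*pi) - N 0 = M (x, w + 2 * pi * \<i>) - M (x, w)"
    using bspec [OF k, of 0] bspec [OF k, of "2*pi"] by (simp add: algebra_simps)
  then show ?thesis
    using M(3) [of x w] by simp
qed

lemma degree_unique:
  assumes "has_degree f d" "has_degree f e"
  shows "d = e"
proof -
  obtain M where M: "continuous_on UNIV M" "\<And>x w. f (x + exp w) - f x = exp (M (x, w))"
      "\<And>x w. M (x, w + 2 * pi * \<i>) = M (x, w) + 2 * pi * \<i> * d"
    using assms(1) unfolding has_degree_def by blast
  have "continuous_on {0..2*pi} (\<lambda>s. M (0, \<i> * s))"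
    by (intro continuous_on_compose2 [OF M(1)] continuous_intros) auto
  moreover have "f (0 + exp (0 + \<i> * s)) - f 0 = exp (M (0, \<i> * s))" for s :: real
    using M(2) [of 0] by simp
  ultimately have "M (0, \<i> * (2 * pi)) - M (0, \<i> * 0) = 2 * pi * \<i> * e"
    using degree_from_circle [OF assms(2), of "\<lambda>s. M (0, \<i> * s)" 0 0] by simp
  then have "M (0, 2 * pi * \<i>) - M (0, 0) = 2 * pi * \<i> * e"
    by (simp add: mult_ac)
  then show ?thesis
    using M(3) [of 0 0] by simp
qed

lemma degree_lift_shift:
  fixes M :: "'a \<times> complex \<Rightarrow> complex" and d k :: int
  assumes M: "\<And>x w. M (x, w + 2 * pi * \<i>) = M (x, w) + 2 * pi * \<i> * d"
  shows "M (x, w + 2 * pi * \<i> * of_int k) = M (x, w) + 2 * pi * \<i> * d * of_int k"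
proof -
  have nat: "M (x, w + 2 * pi * \<i> * of_nat n) = M (x, w) + 2 * pi * \<i> * d * of_nat n" for x w n
  proof (induction n)
    case (Suc n)
    show ?case
      using M [of x "w + 2 * pi * \<i> * of_nat n"] Suc by (simp add: algebra_simps)
  qed simp
  show ?thesis
  proof (cases k)
    case (nonneg n)
    then show ?thesis using nat by simp
  next
    case (neg n)
    then have "w = w + 2 * pi * \<i> * of_int k + 2 * pi * \<i> * of_nat (Suc n)"
      unfolding neg by (simp add: algebra_simps)
    then have "M (x, w) = M (x, w + 2 * pi * \<i> * of_int k) + 2 * pi * \<i> * d * of_nat (Suc n)"
      using nat by metis
    then show ?thesis unfolding neg by (simp add: algebra_simps)
  qed
qed

text \<open>
  If \<open>M\<close> and \<open>L\<close> are the logarithms for \<open>f\<close> and \<open>g\<close>, then substituting \<open>L\<close> for the second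
  argument of \<open>M\<close> gives one for the composition: \<open>g (x + exp w)\<close> is \<open>g x + exp (L (x, w))\<close>.
\<close>

lemma degree_compose:
  assumes "has_degree f d" "has_degree g e" and cg: "continuous_on UNIV g"
  shows "has_degree (f \<circ> g) (d * e)"
proof -
  obtain M where M: "continuous_on UNIV M" "\<And>x w. f (x + exp w) - f x = exp (M (x, w))"
      "\<And>x w. M (x, w + 2 * pi * \<i>) = M (x, w) + 2 * pi * \<i> * d"
    using assms(1) unfolding has_degree_def by blast
  obtain L where L: "continuous_on UNIV L" "\<And>x w. g (x + exp w) - g x = exp (L (x, w))"
      "\<And>x w. L (x, w + 2 * pi * \<i>) = L (x, w) + 2 * pi * \<i> * e"
    using assms(2) unfolding has_degree_def by blast
  note int = degree_lift_shift [of M, OF M(3)]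
  define K where "K = (\<lambda>z. M (g (fst z), L z))"
  have "continuous_on UNIV K"
    unfolding K_def
    by (intro continuous_on_compose2 [OF M(1)] continuous_intros continuous_on_compose2 [OF cg] L(1)) auto
  moreover have "(f \<circ> g) (x + exp w) - (f \<circ> g) x = exp (K (x, w))" for x w
  proof -
    have "g x + exp (L (x, w)) = g (x + exp w)" using L(2) [of x w] by (simp add: algebra_simps)
    then show ?thesis using M(2) [of "g x" "L (x, w)"] by (simp add: K_def)
  qed
  moreover have "K (x, w + 2 * pi * \<i>) = K (x, w) + 2 * pi * \<i> * (d * e)" for x w
    using int [of "g x" "L (x, w)" e] unfolding K_def by (simp only: fst_conv L(3) of_int_mult mult.assoc)
  ultimately show ?thesis
    unfolding has_degree_def by (intro exI [of _ K]) simp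
qed

text \<open>
  Exchanging the two points negates the difference of their values. In the parameters the
  exchange is \<open>(x, w) \<mapsto> (x + exp w, w + pi * \<i>)\<close>, so this adds a constant odd multiple of \<open>pi * \<i>\<close> to \<open>M\<close>.
  Doing it twice is one full turn of \<open>w\<close>, which identifies the odd number as the degree.
\<close>

lemma degree_antisymmetry:
  assumes "continuous_on UNIV M"
    and M: "\<And>x w. f (x + exp w) - f x = exp (M (x, w))"
      "\<And>x w. M (x, w + 2 * pi * \<i>) = M (x, w) + 2 * pi * \<i> * of_int d"
  obtains c where "d = 2 * c + 1" "\<And>x w. M (x + exp w, w + pi * \<i>) = M (x, w) + pi * \<i> * of_int d"
proof -
  have c: "continuous_on UNIV (\<lambda>z. M (fst z + exp (snd z), snd z + pi * \<i>))"
    "continuous_on UNIV (\<lambda>z. M z + pi * \<i>)"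
    by (intro continuous_on_compose2 [OF assms(1)] continuous_intros assms(1); simp)+
  have e: "exp (w + pi * \<i>) = - exp w" for w :: complex
    by (simp add: exp_add)
  have "exp (M (fst z + exp (snd z), snd z + pi * \<i>)) = exp (M z + pi * \<i>)" for z
    unfolding M(1) [symmetric] e using M(1) [of "fst z" "snd z"] by (simp add: algebra_simps)
  then obtain k :: int
    where k: "\<forall>z\<in>UNIV.
      M (fst z + exp (snd z), snd z + pi * \<i>) = M z + pi * \<i> + 2 * pi * \<i> * k"
    by (rule exp_lifts_differ_by_constant [OF connected_UNIV c])
  have step: "M (x + exp w, w + pi * \<i>) = M (x, w) + pi * \<i> * of_int (2 * k + 1)" for x w
    using bspec [OF k, of "(x, w)"] by (simp add: algebra_simps)
  have "M (0, 2 * pi * \<i>) = M (0, 0) + 2 * pi * \<i> * of_int (2 * k + 1)"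
    using step [of 0 0] step [of 1 "pi * \<i>"] by (simp add: algebra_simps)
  then have "(of_int d :: complex) = of_int (2 * k + 1)"
    using M(2) [of 0 0] by (simp del: of_int_add of_int_mult)
  then have "d = 2 * k + 1" by (simp only: of_int_eq_iff)
  then show ?thesis using step that by blast
qed

lemma degree_odd:
  assumes "has_degree f d"
  shows "odd d"
proof -
  obtain M where M: "continuous_on UNIV M" "\<And>x w. f (x + exp w) - f x = exp (M (x, w))"
      "\<And>x w. M (x, w + 2 * pi * \<i>) = M (x, w) + 2 * pi * \<i> * d"
    using assms unfolding has_degree_def by blast
  show ?thesis
    by (rule degree_antisymmetry [OF M]) simp
qed

text \<open>
  Let \<open>W\<close> be a logarithm of the displacement \<open>f y - y\<close>. Then \<open>f (f y) - f y\<close> has the two logarithms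
  \<open>W (f y)\<close> and \<open>M (y, W y)\<close>, which differ by a constant. On a cycle \<open>x, f x\<close> the values of \<open>W\<close> differ by
  an odd multiple of \<open>pi * \<i>\<close>, and the antisymmetry of \<open>M\<close> in degree one makes \<open>M\<close> change
  by that same amount from \<open>x\<close> to \<open>f x\<close>. Going once round the cycle would thus add twice this multiple to
  \<open>W x\<close>.
\<close>

theorem degree_one_no_two_cycle:
  assumes cont: "continuous_on UNIV f" and deg: "has_degree f 1"
    and free: "\<And>x. f x \<noteq> x"
  shows "f (f x) \<noteq> x"
proof
  assume per: "f (f x) = x"
  obtain M where M: "continuous_on UNIV M" "\<And>x w. f (x + exp w) - f x = exp (M (x, w))"
      "\<And>x w. M (x, w + 2 * pi * \<i>) = M (x, w) + 2 * pi * \<i> * of_int 1"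
    using deg unfolding has_degree_def by blast
  have anti: "M (x + exp w, w + pi * \<i>) = M (x, w) + pi * \<i>" for x w
    using degree_antisymmetry [OF M] by (metis mult.right_neutral of_int_1)
  have "continuous_on UNIV (\<lambda>y. f y - y)"
    by (intro continuous_intros cont)
  moreover have "f y - y \<noteq> 0" for y
    using free by simp
  ultimately obtain W where W: "continuous_on UNIV W" "\<And>y. y \<in> UNIV \<Longrightarrow> f y - y = exp (W y)"
    by (rule continuous_logarithm_on_contractible [OF _ convex_imp_contractible [OF convex_UNIV]]) blast
  note W = W(1) W(2) [OF UNIV_I]
  have shift: "y + exp (W y) = f y" for y
    using W(2) [of y] by (simp add: algebra_simps)
  have "continuous_on UNIV (\<lambda>y. W (f y))" "continuous_on UNIV (\<lambda>y. M (y, W y))"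
    by (auto intro!: continuous_on_compose2 [OF W(1)] continuous_on_compose2 [OF M(1)]
        continuous_intros cont W(1))
  moreover have "exp (W (f y)) = exp (M (y, W y))" for y
    using W(2) [of "f y"] M(2) [of y "W y"] shift by simp
  ultimately obtain k :: int where k: "\<forall>y\<in>UNIV. W (f y) = M (y, W y) + 2 * pi * \<i> * k"
    by (rule exp_lifts_differ_by_constant [OF connected_UNIV])
  note k = bspec [OF k UNIV_I]
  have "exp (W (f x)) = exp (W x + pi * \<i>)"
    using W(2) [of x, symmetric] W(2) [of "f x", symmetric] per by (simp add: exp_add)
  then obtain m :: int where m: "W (f x) = W x + pi * \<i> + 2 * pi * \<i> * of_int m"
    by (force simp: exp_eq algebra_simps)
  have twist: "M (y, w + 2 * pi * \<i> * of_int m) = M (y, w) + 2 * pi * \<i> * of_int m" for y w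
    using degree_lift_shift [of M, OF M(3)] by (simp only: of_int_1 mult.right_neutral)
  have "W x = M (f x, W (f x)) + 2 * pi * \<i> * k"
    using k [of "f x"] per by simp
  also have "\<dots> = M (f x, W x + pi * \<i>) + 2 * pi * \<i> * m + 2 * pi * \<i> * k"
    unfolding m twist ..
  also have "\<dots> = W (f x) + pi * \<i> + 2 * pi * \<i> * m"
    using anti [of x "W x"] shift [of x] k [of x] by simp
  also have "\<dots> = W x + 2 * pi * \<i> * of_int (2 * m + 1)"
    by (simp add: m algebra_simps)
  finally have "(of_int (2 * m + 1) :: complex) = 0"
    by (simp del: of_int_add of_int_mult)
  then have "2 * m + 1 = 0" by (simp only: of_int_eq_0_iff)
  then show False by presburger
qed

section \<open>Recurrence forces a fixed point\<close>

text \<open>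
  The class of maps to which Brouwer's theorem applies; it is chosen so as to be stable under the
  perturbations of \<open>brouwer_map_push\<close>.
\<close>

definition brouwer_map :: "(complex \<Rightarrow> complex) \<Rightarrow> bool" where
  "brouwer_map f \<longleftrightarrow>
     continuous_on UNIV f \<and> inj f \<and> has_degree f 1 \<and> (\<forall>x. f x \<noteq> x)"

text \<open>
  The degree can be read off from a circle that lies, with its centre, in the region where the map is
  the identity.
\<close>

lemma degree_one_if_identity_far_out:
  assumes "continuous_on UNIV h" "inj h" and bd: "bounded {x. h x \<noteq> x}"
  shows "has_degree h 1"
proof -
  obtain d where d: "has_degree h d"
    using degree_exists [OF assms(1,2)] .
  obtain b where b: "b > 0" "\<And>x. h x \<noteq> x \<Longrightarrow> norm x \<le> b"
    using bd by (auto simp: bounded_pos)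
  define x where "x = complex_of_real (b + 2)"
  have "h x = x"
    using b by (force simp: x_def simp del: of_real_add)
  moreover have "h (x + exp (0 + \<i> * s)) = x + exp (0 + \<i> * s)" for s :: real
  proof -
    have "norm x - norm (exp (\<i> * s)) \<le> norm (x + exp (\<i> * s))"
      using norm_diff_ineq by blast
    moreover have "norm x = b + 2"
      using b by (simp add: x_def del: of_real_add)
    ultimately show ?thesis
      using b(2) [of "x + exp (\<i> * s)"] by fastforce
  qed
  ultimately have "\<i> * complex_of_real (2 * pi) - \<i> * complex_of_real 0 = 2 * pi * \<i> * d"
    by (intro degree_from_circle [OF d, of _ x 0]) (auto intro!: continuous_intros)
  then show ?thesis
    using d by simp
qed

text \<open>
  A push supported in a set \<open>U\<close> that is disjoint from its image creates no fixed point: if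
  \<open>h (f z) = z\<close> and \<open>f z\<close> is in \<open>U\<close>, then \<open>z\<close> is not in \<open>U\<close>, but \<open>h\<close> maps \<open>U\<close> onto itself.
\<close>

lemma brouwer_map_push:
  assumes f: "brouwer_map f" and U: "open U" "connected U" and free: "f ` U \<inter> U = {}"
    and "a \<in> U" "b \<in> U"
  obtains h where "h a = b" "\<And>z. z \<notin> U \<Longrightarrow> h z = z" "brouwer_map (h \<circ> f)"
proof -
  have aff: "affine hull U = UNIV"
    using U \<open>a \<in> U\<close> affine_hull_open by blast
  obtain h k where hk: "homeomorphism UNIV UNIV h k" "h a = b"
      and moved: "{x. \<not> (h x = x \<and> k x = x)} \<subseteq> U"
      and bd: "bounded {x. \<not> (h x = x \<and> k x = x)}"
    by (rule homeomorphism_moving_point [of U UNIV a b]) (use assms aff in auto)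
  have stay: "h z = z" if "z \<notin> U" for z
    using moved that by blast
  have conth: "continuous_on UNIV h"
    using hk(1) homeomorphism_def by blast
  have injh: "inj h"
    by (metis (mono_tags) UNIV_I hk(1) homeomorphism_apply1 injI)
  have "bounded {x. h x \<noteq> x}"
    by (rule bounded_subset [OF bd]) auto
  then have "has_degree h 1"
    using degree_one_if_identity_far_out conth injh by blast
  then have "has_degree (h \<circ> f) 1"
    using degree_compose [of h 1 f 1] f by (simp add: brouwer_map_def)
  moreover have "continuous_on UNIV (h \<circ> f)"
    using f conth unfolding brouwer_map_def by (meson continuous_on_compose continuous_on_subset subset_UNIV)
  moreover have "inj (h \<circ> f)"
    using f injh by (simp add: brouwer_map_def inj_compose)
  moreover have "h (f z) \<noteq> z" for z
  proof
    assume eq: "h (f z) = z"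
    show False
    proof (cases "f z \<in> U")
      case True
      then have "z \<notin> U" using free by blast
      then have "h z = h (f z)" using stay eq by simp
      then have "z = f z" using injh by (simp add: inj_eq)
      then show False using f by (metis brouwer_map_def)
    next
      case False
      then show False using stay eq f by (metis brouwer_map_def)
    qed
  qed
  ultimately have "brouwer_map (h \<circ> f)"
    by (simp add: brouwer_map_def)
  with hk(2) stay show ?thesis by (rule that)
qed

lemma funpow_unaffected:
  fixes f h :: "'a \<Rightarrow> 'a"
  assumes "\<And>j. 0 < j \<Longrightarrow> j \<le> n \<Longrightarrow> h ((f ^^ j) a) = (f ^^ j) a"
  shows "((h \<circ> f) ^^ n) a = (f ^^ n) a"
  using assms
proof (induction n)
  case (Suc n)
  then show ?case using Suc.prems [of "Suc n"] by simp
qed simp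

text \<open>
  A first return of \<open>a\<close> to \<open>U\<close> could be pushed back to \<open>a\<close> inside \<open>U\<close>, which would close the orbit
  up. The hypothesis bounds the excluded periods by \<open>k\<close> so that the lemma can be used within the induction on
  the period.
\<close>

lemma brouwer_map_no_return:
  assumes aper: "\<And>g x j. brouwer_map g \<Longrightarrow> 0 < j \<Longrightarrow> j \<le> k \<Longrightarrow> (g ^^ j) x \<noteq> x"
    and f: "brouwer_map f" and U: "open U" "connected U" and free: "f ` U \<inter> U = {}"
    and a: "a \<in> U" and "0 < k"
  shows "(f ^^ k) a \<notin> U"
proof
  assume ret: "(f ^^ k) a \<in> U"
  define j where "j = (LEAST j. 0 < j \<and> (f ^^ j) a \<in> U)"
  have j: "0 < j" "(f ^^ j) a \<in> U" "j \<le> k"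
    using LeastI [of "\<lambda>j. 0 < j \<and> (f ^^ j) a \<in> U" k] Least_le [of "\<lambda>j. 0 < j \<and> (f ^^ j) a \<in> U" k]
      ret \<open>0 < k\<close> by (auto simp: j_def)
  have early: "(f ^^ m) a \<notin> U" if "0 < m" "m < j" for m
    using not_less_Least that unfolding j_def by blast
  obtain h where h: "h ((f ^^ j) a) = a" "\<And>z. z \<notin> U \<Longrightarrow> h z = z" "brouwer_map (h \<circ> f)"
    using brouwer_map_push [OF f U free j(2) a] by blast
  obtain i where i: "j = Suc i" using j(1) gr0_implies_Suc by blast
  have "((h \<circ> f) ^^ i) a = (f ^^ i) a"
    by (rule funpow_unaffected) (use early h(2) i in auto)
  then have "((h \<circ> f) ^^ j) a = a"
    using h(1) i by simp
  then show False using aper [OF h(3) j(1,3)] by blast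
qed

text \<open>
  The largest open ball around \<open>x\<close> that is disjoint from its image. Its radius is the minimum over
  \<open>z\<close> of the larger of the distances of \<open>z\<close> and \<open>f z\<close> from \<open>x\<close>. At a minimiser both
  distances are equal: otherwise, as \<open>f\<close> is continuous and open, a nearby point of the ball would have its image in
  the ball.
\<close>

lemma critical_ball:
  assumes f: "brouwer_map f"
  obtains r y where "r > 0" "f ` ball x r \<inter> ball x r = {}" "dist x y = r" "dist x (f y) = r"
proof -
  have cont: "continuous_on UNIV f" and inj: "inj f" and free: "\<And>z. f z \<noteq> z"
    using f by (auto simp: brouwer_map_def)
  define \<phi> where "\<phi> = (\<lambda>z. max (dist x z) (dist x (f z)))"
  define R where "R = dist x (f x)"
  have cont_\<phi>: "continuous_on (cball x R) \<phi>"
    unfolding \<phi>_def by (intro continuous_intros continuous_on_subset [OF cont]) auto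
  have xR: "x \<in> cball x R" by (simp add: R_def)
  then have "cball x R \<noteq> {}" by blast
  from continuous_attains_inf [OF compact_cball this cont_\<phi>]
  obtain y where y: "y \<in> cball x R" "\<And>z. z \<in> cball x R \<Longrightarrow> \<phi> y \<le> \<phi> z"
    by blast
  have min: "\<phi> y \<le> \<phi> z" for z
  proof (cases "z \<in> cball x R")
    case False
    then have "R \<le> \<phi> z" by (simp add: \<phi>_def)
    then show ?thesis using y(2) [OF xR] by (simp add: \<phi>_def R_def)
  qed (rule y(2))
  define r where "r = \<phi> y"
  have pos: "r > 0"
  proof (rule ccontr)
    assume "\<not> r > 0"
    then have "dist x y \<le> 0" "dist x (f y) \<le> 0"
      unfolding r_def \<phi>_def by linarith+
    then have "x = y" "x = f y" by simp_all
    then show False using free by metis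
  qed
  have off: False if "z \<in> ball x r" "f z \<in> ball x r" for z
  proof -
    have "\<phi> z < r"
      using that by (simp add: \<phi>_def)
    then show False
      using min [of z] by (simp add: r_def)
  qed
  have clo: "closure (ball x r) = cball x r"
    using pos by simp
  have le: "dist x y \<le> r" "dist x (f y) \<le> r" by (auto simp: r_def \<phi>_def)
  have "dist x y = r"
  proof (rule ccontr)
    assume "dist x y \<noteq> r"
    then have "f y \<in> f ` ball x r" using le by simp
    moreover have "open (f ` ball x r)"
      using invariance_of_domain [OF continuous_on_subset [OF cont] open_ball inj_on_subset [OF inj]]
      by simp
    moreover have "f y \<in> closure (ball x r)" using le clo by simp
    ultimately have "f ` ball x r \<inter> ball x r \<noteq> {}"
      using open_Int_closure_eq_empty by blast
    then show False using off by blast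
  qed
  moreover have "dist x (f y) = r"
  proof (rule ccontr)
    assume "dist x (f y) \<noteq> r"
    then have "y \<in> f -` ball x r" using le by simp
    moreover have "open (f -` ball x r)"
      using cont by (simp add: open_vimage)
    moreover have "y \<in> closure (ball x r)" using le clo by simp
    ultimately have "f -` ball x r \<inter> ball x r \<noteq> {}"
      using open_Int_closure_eq_empty by blast
    then show False using off by blast
  qed
  ultimately show ?thesis
    using that pos off by blast
qed

text \<open>
  Being disjoint from its image is an open property of a compact set, and the component of a
  neighbourhood that contains the set is again a neighbourhood.
\<close>

lemma free_connected_neighbourhood:
  fixes f :: "'a::euclidean_space \<Rightarrow> 'a"
  assumes A: "compact A" "connected A" and cont: "continuous_on UNIV f"
    and free: "f ` A \<inter> A = {}" and K: "finite K" "K \<inter> A = {}"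
  obtains U where "open U" "connected U" "A \<subseteq> U" "f ` U \<inter> U = {}" "K \<inter> U = {}"
proof (cases "A = {}")
  case False
  then obtain a where a: "a \<in> A" by blast
  have "compact (f ` A)"
    using compact_continuous_image A(1) cont continuous_on_subset by blast
  then obtain P Q where PQ: "open P" "open Q" "A \<subseteq> P" "f ` A \<subseteq> Q" "P \<inter> Q = {}"
    using separation_normal [of A "f ` A"] compact_imp_closed A(1) free by (metis inf_commute)
  define W where "W = P \<inter> f -` Q - K"
  have "open W"
    unfolding W_def by (intro open_Diff open_Int open_vimage PQ cont finite_imp_closed K(1))
  moreover have "A \<subseteq> W"
    using PQ K by (auto simp: W_def)
  ultimately show ?thesis
    using a A(2) PQ(5) connected_component_subset [of W a]
    by (intro that [of "connected_component_set W a"])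
      (auto simp: open_connected_component connected_component_maximal W_def)
qed (use that [of "{}"] in auto)

lemma segment_to_sphere_in_ball:
  fixes x :: "'a::real_normed_vector"
  assumes "a \<in> ball x r" "dist x b = r"
  shows "closed_segment a b \<subseteq> insert b (ball x r)"
proof
  fix z assume "z \<in> closed_segment a b"
  then obtain t where t: "0 \<le> t" "t \<le> 1" "z = (1 - t) *\<^sub>R a + t *\<^sub>R b"
    by (auto simp: in_segment)
  show "z \<in> insert b (ball x r)"
  proof (cases "t = 1")
    case False
    have "x - z = (1 - t) *\<^sub>R (x - a) + t *\<^sub>R (x - b)"
      by (simp add: t(3) algebra_simps)
    then have "norm (x - z) \<le> (1 - t) * norm (x - a) + t * norm (x - b)"
      using norm_triangle_ineq [of "(1 - t) *\<^sub>R (x - a)" "t *\<^sub>R (x - b)"] t by simp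
    also have "\<dots> < (1 - t) * r + t * r"
      using assms False t by (intro add_less_le_mono mult_strict_left_mono) (auto simp: dist_norm)
    finally show ?thesis by (simp add: dist_norm algebra_simps)
  qed (use t in simp)
qed

lemma radii_disjoint:
  fixes x :: "'a::real_normed_vector"
  assumes "dist x a = r" "dist x b = r" "r > 0" "a \<noteq> b"
  shows "closed_segment (midpoint x a) a \<inter> closed_segment b x = {}"
proof (rule ccontr)
  assume "\<not> ?thesis"
  then obtain z where z: "z \<in> closed_segment (midpoint x a) a" "z \<in> closed_segment b x" by blast
  obtain s where s: "0 \<le> s" "s \<le> 1" "z = (1 - s) *\<^sub>R midpoint x a + s *\<^sub>R a"
    using z(1) by (auto simp: in_segment)
  obtain t where t: "0 \<le> t" "t \<le> 1" "z = (1 - t) *\<^sub>R b + t *\<^sub>R x"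
    using z(2) by (auto simp: in_segment)
  define c where "c = (1 + s) / 2"
  have "z - x = ((1 - s) / 2) *\<^sub>R (a - x) + s *\<^sub>R (a - x)"
    unfolding s midpoint_def by (simp add: algebra_simps flip: scaleR_add_left)
  then have 1: "z - x = c *\<^sub>R (a - x)"
    by (simp add: c_def field_simps flip: scaleR_add_left)
  have 2: "z - x = (1 - t) *\<^sub>R (b - x)"
    by (simp add: t(3) algebra_simps)
  have "c * r = (1 - t) * r"
    using arg_cong [OF 1, of norm] arg_cong [OF 2, of norm] assms s t
    by (simp add: c_def dist_norm norm_minus_commute)
  then have "c = 1 - t" using assms by simp
  moreover have "c > 0" using s by (simp add: c_def)
  ultimately show False
    using 1 2 assms by simp
qed

text \<open>
  Let \<open>B\<close> be the critical ball around the periodic point \<open>x\<close>, touching its image at \<open>f y\<close>. By the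
  induction hypothesis the images of \<open>B\<close> under fewer than \<open>k\<close> iterations miss \<open>B\<close>. Let \<open>v\<close> be a
  point of the radius from \<open>x\<close> to \<open>f y\<close>. The arc \<open>A\<close> runs from \<open>v\<close> along this radius to \<open>f y\<close> and
  then, along the image of the radius from \<open>y\<close> to \<open>x\<close>, on to \<open>f x\<close>; starting at \<open>v\<close> rather than at
  \<open>x\<close> makes it disjoint from its image, since \<open>f x\<close> is then the end of \<open>A\<close> but not the start of the
  image of \<open>A\<close>. Pushing \<open>x\<close> to \<open>v\<close> inside \<open>B\<close> and then \<open>v\<close> to \<open>f x\<close> near \<open>A\<close> makes the last
  point of the cycle jump to \<open>f x\<close> instead of \<open>x\<close>, so that the period drops to \<open>k - 1\<close>.
\<close>

lemma brouwer_map_no_cycle_step: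
  assumes f: "brouwer_map f" and k: "3 \<le> k"
    and IH: "\<And>g x j. brouwer_map g \<Longrightarrow> 0 < j \<Longrightarrow> j < k \<Longrightarrow> (g ^^ j) x \<noteq> x"
  shows "(f ^^ k) x \<noteq> x"
proof
  assume per: "(f ^^ k) x = x"
  have cont: "continuous_on UNIV f" and inj: "inj f" and nofix: "\<And>z. f z \<noteq> z"
    using f by (auto simp: brouwer_map_def)
  obtain r y where r: "r > 0" and free: "f ` ball x r \<inter> ball x r = {}"
      and y: "dist x y = r" "dist x (f y) = r"
    by (rule critical_ball [OF f])
  define B where "B = ball x r"
  have B: "open B" "connected B" "x \<in> B" "f ` B \<inter> B = {}"
    using r free by (auto simp: B_def)
  have clo: "closure B = cball x r"
    using r by (simp add: B_def)
  have contn: "continuous_on UNIV (f ^^ j)" for j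
  proof (induction j)
    case (Suc j)
    show ?case
      unfolding funpow.simps by (rule continuous_on_compose [OF Suc continuous_on_subset [OF cont]]) simp
  qed (simp add: id_def)
  have injn: "inj (f ^^ j)" for j
    using inj by (induction j) (auto intro: inj_compose)
  have off: "(f ^^ j) z \<notin> B" if "0 < j" "j < k" "z \<in> B" for j z
    by (rule brouwer_map_no_return [OF _ f B(1,2,4)]) (use IH that in auto)
  have off_closure: "(f ^^ j) z \<notin> B" if "0 < j" "j < k" "z \<in> cball x r" for j z
  proof
    assume "(f ^^ j) z \<in> B"
    moreover have "open ((f ^^ j) -` B)" using B(1) contn open_vimage by blast
    ultimately have "(f ^^ j) -` B \<inter> B \<noteq> {}"
      using open_Int_closure_eq_empty that(3) clo by blast
    then show False using off that by blast
  qed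
  have closure_off: "(f ^^ j) z \<notin> cball x r" if "0 < j" "j < k" "z \<in> B" for j z
  proof
    assume "(f ^^ j) z \<in> cball x r"
    moreover have "open ((f ^^ j) ` B)"
      using invariance_of_domain [OF continuous_on_subset [OF contn] B(1) inj_on_subset [OF injn]] by simp
    ultimately have "(f ^^ j) ` B \<inter> B \<noteq> {}"
      using open_Int_closure_eq_empty that(3) clo by blast
    then show False using off that by blast
  qed
  have off1: "f z \<notin> B" if "z \<in> cball x r" for z
    using off_closure [of 1 z] that k by simp
  have off2: "f (f z) \<notin> B" if "z \<in> cball x r" for z
    using off_closure [of 2 z] that k by (simp add: numeral_2_eq_2)
  have closure_off1: "f z \<notin> cball x r" if "z \<in> B" for z
    using closure_off [of 1 z] that k by simp
  have ends: "y \<notin> B" "f y \<notin> B" "y \<in> cball x r" "f y \<in> cball x r" "y \<noteq> f y"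
    using y nofix [of y] by (auto simp: B_def)
  have BC: "B \<subseteq> cball x r" by (auto simp: B_def)

  define v where "v = midpoint x (f y)"
  have v: "v \<in> B"
    using y(2) r dist_midpoint(1) [of x "f y"] by (simp add: v_def B_def)
  define S where "S = closed_segment v (f y)"
  define T where "T = closed_segment y x"
  have S: "S \<subseteq> insert (f y) B"
    unfolding S_def B_def using segment_to_sphere_in_ball v y(2) B_def by blast
  have T: "T \<subseteq> insert y B"
    unfolding T_def B_def using segment_to_sphere_in_ball [of x x r y] r y(1) by (simp add: closed_segment_commute)
  have ST: "S \<inter> T = {}"
    unfolding S_def T_def v_def using radii_disjoint y r nofix by blast
  have SC: "S \<subseteq> cball x r" "T \<subseteq> cball x r" using S T ends BC by auto
  \<comment> \<open>The arc along which the second push takes place.\<close>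
  define A where "A = S \<union> f ` T"
  have inS: "v \<in> S" "f y \<in> S" and inT: "y \<in> T" "x \<in> T" by (auto simp: S_def T_def)
  have compT: "compact (f ` T)" "connected (f ` T)"
    by (auto intro!: compact_continuous_image connected_continuous_image continuous_on_subset [OF cont] simp: T_def)
  then have A: "compact A" "connected A"
    unfolding A_def using inS inT by (auto intro!: compact_Un connected_Un simp: S_def)
  \<comment> \<open>This is why the first push, inside \<open>B\<close>, does not disturb the image of \<open>A\<close>.\<close>
  have fA_off: "f a \<notin> B" if "a \<in> A" for a
    using that off1 off2 SC unfolding A_def by blast
  have fA: "f ` A \<inter> A = {}"
  proof (rule ccontr)
    assume "f ` A \<inter> A \<noteq> {}"
    then obtain b where b: "b \<in> A" "f b \<in> A" by blast
    consider (1) "b \<in> S" "f b \<in> S" | (2) c where "c \<in> T" "b = f c" "f b \<in> S"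
      | (3) "b \<in> S" "f b \<in> f ` T" | (4) c where "c \<in> T" "b = f c" "f b \<in> f ` T"
      using b by (auto simp: A_def)
    then show False
    proof cases
      case 1
      then have "f b = f y" using fA_off [OF b(1)] S by blast
      then have "b = y" using inj by (simp add: inj_eq)
      then show False using 1 S ends by blast
    next
      case 2
      then have "f (f c) = f y" using fA_off [OF b(1)] S by blast
      then have "f c = y" using inj by (simp add: inj_eq)
      then show False using 2(1) T closure_off1 ends by (metis insertE subsetD)
    next
      case 3
      then have "b \<in> T" using inj by (auto simp: inj_eq)
      then show False using 3 ST by blast
    next
      case 4
      then have fc: "f c \<in> T" using inj by (auto simp: inj_eq)
      then have "f c \<in> cball x r" using SC(2) by (rule subsetD [rotated])
      then have "c \<notin> B" using closure_off1 [of c] by blast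
      then have "c = y" using subsetD [OF T 4(1)] by simp
      then show False using subsetD [OF T fc] ends by simp
    qed
  qed

  obtain h where h: "h x = v" "\<And>z. z \<notin> B \<Longrightarrow> h z = z" and hf: "brouwer_map (h \<circ> f)"
    using brouwer_map_push [OF f B(1,2,4) B(3) v] by blast
  have "(h \<circ> f) ` A \<inter> A = {}"
    using fA fA_off h(2) by auto
  moreover
  \<comment> \<open>The points of the cycle that the second push must not move.\<close>
  define K where "K = (\<lambda>j. (f ^^ j) x) ` {2..<k}"
  have "K \<inter> A = {}"
  proof -
    have "(f ^^ j) x \<notin> A" if j: "2 \<le> j" "j < k" for j
    proof
      assume a: "(f ^^ j) x \<in> A"
      obtain i where i: "j = Suc i" using j(1) by (cases j) auto
      then have "(f ^^ i) x \<notin> cball x r" "(f ^^ j) x \<notin> B"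
        using closure_off [of i x] off [of j x] j i B(3) by auto
      moreover from this(2) have "(f ^^ j) x \<in> f ` insert y T"
        using a S by (auto simp add: A_def simp del: funpow.simps)
      then have "(f ^^ i) x \<in> insert y T"
        using i inj by (auto simp: inj_eq)
      ultimately show False using SC ends by blast
    qed
    then show ?thesis by (auto simp: K_def)
  qed
  moreover have "finite K" "continuous_on UNIV (h \<circ> f)"
    using hf by (auto simp: K_def brouwer_map_def)
  ultimately obtain U where U: "open U" "connected U" "A \<subseteq> U" "(h \<circ> f) ` U \<inter> U = {}" "K \<inter> U = {}"
    using free_connected_neighbourhood [OF A, of "h \<circ> f" K] by metis
  have "v \<in> U" "f x \<in> U" using U(3) inS inT by (auto simp: A_def)
  then obtain g where g: "g v = f x" "\<And>z. z \<notin> U \<Longrightarrow> g z = z" "brouwer_map (g \<circ> (h \<circ> f))"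
    using brouwer_map_push [OF hf U(1,2,4)] by blast
  have short: "(((g \<circ> h) \<circ> f) ^^ (k - 2)) (f x) = (f ^^ (k - 2)) (f x)"
  proof (rule funpow_unaffected)
    fix j assume j: "0 < j" "j \<le> k - 2"
    then have "(f ^^ Suc j) x \<in> K" "(f ^^ Suc j) x \<notin> B"
      using k off [of "Suc j" x] B(3) by (auto simp: K_def simp del: funpow.simps)
    then have "(f ^^ j) (f x) \<notin> B" "(f ^^ j) (f x) \<notin> U"
      using U(5) by (auto simp: funpow_swap1)
    then show "(g \<circ> h) ((f ^^ j) (f x)) = (f ^^ j) (f x)"
      using h(2) g(2) by simp
  qed
  have "k = Suc (Suc (k - 2))" using k by simp
  then have "f ((f ^^ (k - 2)) (f x)) = x"
    using per by (metis comp_apply funpow.simps(2) funpow_swap1)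
  then have "(((g \<circ> h) \<circ> f) ^^ Suc (k - 2)) (f x) = f x"
    using short g h by simp
  moreover have "brouwer_map ((g \<circ> h) \<circ> f)"
    using g(3) by (simp add: comp_assoc)
  ultimately show False using IH [of "(g \<circ> h) \<circ> f" "Suc (k - 2)"] k by auto
qed

theorem brouwer_map_aperiodic:
  assumes "brouwer_map f" "0 < k"
  shows "(f ^^ k) x \<noteq> x"
  using assms
proof (induction k arbitrary: f x rule: less_induct)
  case (less k)
  consider "k = 1" | "k = 2" | "3 \<le> k" using less.prems(2) by linarith
  then show ?case
  proof cases
    case 1
    then show ?thesis using less.prems by (simp add: brouwer_map_def)
  next
    case 2
    then show ?thesis
      using degree_one_no_two_cycle [of f x] less.prems by (simp add: brouwer_map_def numeral_2_eq_2)
  next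
    case 3
    show ?thesis
      using less.prems(1) 3 by (rule brouwer_map_no_cycle_step) (rule less.IH)
  qed
qed

corollary brouwer_map_free_set_wanders:
  assumes "brouwer_map f" "open U" "connected U" "f ` U \<inter> U = {}" "a \<in> U" "0 < k"
  shows "(f ^^ k) a \<notin> U"
proof -
  have aper: "(g ^^ j) x \<noteq> x" if "brouwer_map g" "0 < j" "j \<le> k" for g x j
    using that(1,2) by (rule brouwer_map_aperiodic)
  show ?thesis
    by (rule brouwer_map_no_return [of k f U a]) (fact aper assms)+
qed

section \<open>Maps preserving a half-plane\<close>

text \<open>
  A factor \<open>Q\<close> avoiding the nonpositive real axis does not contribute to the degree, because the principal
  logarithm is continuous along it.
\<close>

lemma degree_from_quotient:
  fixes e :: int
  assumes "has_degree f d" and Q: "continuous_on {0..2*pi} Q" "Q (2*pi) = Q 0"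
    and neg: "\<And>s. s \<in> {0..2*pi} \<Longrightarrow> Q s \<notin> \<real>\<^sub>\<le>\<^sub>0"
    and eq: "\<And>s. s \<in> {0..2*pi} \<Longrightarrow>
      f (x + exp (w + \<i> * complex_of_real s)) - f x = Q s * exp (\<i> * of_int e * complex_of_real s + c)"
  shows "d = e"
proof -
  define N where "N = (\<lambda>s. Ln (Q s) + (\<i> * of_int e * complex_of_real s + c))"
  have "N (2*pi) - N 0 = 2 * pi * \<i> * d"
  proof (rule degree_from_circle [OF assms(1)])
    show "continuous_on {0..2*pi} N"
      unfolding N_def by (intro continuous_intros Q) (use neg in auto)
    fix s :: real assume s: "s \<in> {0..2*pi}"
    then have "Q s \<noteq> 0" using neg by force
    then show "f (x + exp (w + \<i> * s)) - f x = exp (N s)"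
      using eq [OF s] unfolding N_def exp_add [of "Ln (Q s)"] by simp
  qed
  moreover have "N (2*pi) - N 0 = 2 * pi * \<i> * e"
    by (simp add: N_def Q(2))
  ultimately show ?thesis by simp
qed

text \<open>
  A diffeomorphism of the plane onto the upper half-plane, through which Brouwer's theorem is
  transported. As a map into the plane it has degree one, because the real part of
  \<open>(to_half_plane x - to_half_plane y) * cnj (x - y)\<close> is positive for \<open>x \<noteq> y\<close>.
\<close>

definition to_half_plane :: "complex \<Rightarrow> complex" where
  "to_half_plane z = Complex (Re z) (exp (Im z))"

definition from_half_plane :: "complex \<Rightarrow> complex" where
  "from_half_plane z = Complex (Re z) (ln (Im z))"

lemma Im_to_half_plane [simp]: "Im (to_half_plane z) > 0"
  by (simp add: to_half_plane_def)

lemma from_to_half_plane [simp]: "from_half_plane (to_half_plane z) = z"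
  by (simp add: to_half_plane_def from_half_plane_def)

lemma to_from_half_plane: "Im z > 0 \<Longrightarrow> to_half_plane (from_half_plane z) = z"
  by (simp add: to_half_plane_def from_half_plane_def)

lemma inj_to_half_plane: "inj to_half_plane"
  by (metis from_to_half_plane injI)

lemma continuous_to_half_plane: "continuous_on UNIV to_half_plane"
  unfolding to_half_plane_def complex_eq_iff Complex_eq
  by (intro continuous_intros)

lemma continuous_from_half_plane: "continuous_on {z. Im z > 0} from_half_plane"
  unfolding from_half_plane_def Complex_eq
  by (intro continuous_intros) auto

lemma degree_to_half_plane: "has_degree to_half_plane 1"
proof -
  obtain d where d: "has_degree to_half_plane d"
    using degree_exists [OF continuous_to_half_plane inj_to_half_plane] .
  define Q where "Q = (\<lambda>s. (to_half_plane (cis s) - to_half_plane 0) * cis (- s))"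
  have cont: "continuous_on {0..2*pi} Q"
    unfolding Q_def
    by (intro continuous_intros continuous_on_compose2 [OF continuous_to_half_plane]) auto
  have "Q s \<notin> \<real>\<^sub>\<le>\<^sub>0" for s
  proof -
    have pos: "(exp u - 1) * u > 0" if "u \<noteq> 0" for u :: real
      using that by (cases u "0::real" rule: linorder_cases) (auto intro: mult_pos_pos mult_neg_neg)
    have "Re (Q s) = cos s * cos s + (exp (sin s) - 1) * sin s"
      by (simp add: Q_def to_half_plane_def)
    moreover have "\<dots> > 0"
    proof (cases "sin s = 0")
      case True
      then have "cos s \<noteq> 0" using sin_cos_squared_add [of s] by auto
      then have "cos s * cos s > 0" by (metis not_real_square_gt_zero)
      then show ?thesis using True by simp
    next
      case False
      then show ?thesis using pos [OF False] by (intro add_nonneg_pos) auto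
    qed
    ultimately show ?thesis by (auto simp: complex_nonpos_Reals_iff)
  qed
  moreover have "to_half_plane (0 + exp (0 + \<i> * complex_of_real s)) - to_half_plane 0 =
      Q s * exp (\<i> * of_int 1 * complex_of_real s + 0)" for s
    by (simp add: Q_def cis_conv_exp mult.assoc exp_minus)
  moreover have "Q (2*pi) = Q 0"
    by (simp add: Q_def cis.code)
  ultimately have "d = 1"
    by (intro degree_from_quotient [OF d cont])
  then show ?thesis using d by simp
qed

text \<open>
  The conjugate \<open>G\<close> of \<open>g\<close> by \<open>to_half_plane\<close> has no fixed point, and it has degree one since degrees
  multiply in \<open>to_half_plane \<circ> G = g \<circ> to_half_plane\<close>. An orbit accumulating at \<open>q\<close> would visit every
  neighbourhood of \<open>q\<close> twice, also one that is disjoint from its image.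
\<close>

lemma half_plane_no_recurrence:
  assumes g: "continuous_on UNIV g" "inj g" "has_degree g 1"
    and up: "\<And>z. Im z > 0 \<Longrightarrow> Im (g z) > 0"
    and free: "\<And>z. Im z > 0 \<Longrightarrow> g z \<noteq> z"
    and "Im p > 0" "Im q > 0" and r: "strict_mono r"
    and lim: "(\<lambda>n. (g ^^ r n) p) \<longlonglongrightarrow> q"
  shows False
proof -
  define G where "G = from_half_plane \<circ> g \<circ> to_half_plane"
  have conj: "to_half_plane (G z) = g (to_half_plane z)" for z
    by (simp add: G_def to_from_half_plane up)
  have conjn: "(G ^^ n) (from_half_plane z) = from_half_plane ((g ^^ n) z)"
       "Im ((g ^^ n) z) > 0" if "Im z > 0" for n z
  proof (induction n)
    case (Suc n)
    { case 1 then show ?case using Suc by (simp add: G_def to_from_half_plane) }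
    { case 2 then show ?case using Suc by (simp add: up) }
  qed (use that in auto)
  have contG: "continuous_on UNIV G"
    unfolding G_def comp_def
    by (intro continuous_on_compose2 [OF continuous_from_half_plane]
        continuous_on_compose2 [OF g(1)] continuous_to_half_plane) (auto simp: up)
  moreover have injG: "inj G"
    using conj g(2) inj_to_half_plane by (metis injD injI)
  moreover have "G z \<noteq> z" for z
    using conj free by (metis Im_to_half_plane)
  moreover have "has_degree G 1"
  proof -
    obtain d where d: "has_degree G d"
      using degree_exists [OF contG injG] .
    have "has_degree (to_half_plane \<circ> G) (1 * d)"
      by (rule degree_compose [OF degree_to_half_plane d contG])
    moreover have "has_degree (g \<circ> to_half_plane) (1 * 1)"
      by (rule degree_compose [OF g(3) degree_to_half_plane continuous_to_half_plane])
    moreover have "to_half_plane \<circ> G = g \<circ> to_half_plane"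
      by (simp add: fun_eq_iff conj)
    ultimately have "d = 1" using degree_unique by force
    then show ?thesis using d by simp
  qed
  ultimately have G: "brouwer_map G" by (simp add: brouwer_map_def)
  define q' where "q' = from_half_plane q"
  have "G ` {q'} \<inter> {q'} = {}" using G by (simp add: brouwer_map_def)
  then obtain U where U: "open U" "connected U" "{q'} \<subseteq> U" "G ` U \<inter> U = {}"
    using free_connected_neighbourhood [of "{q'}" G "{}"] contG by auto
  have "isCont from_half_plane q"
    using continuous_from_half_plane \<open>Im q > 0\<close>
    by (simp add: continuous_on_eq_continuous_at open_halfspace_Im_gt)
  then have "(\<lambda>n. from_half_plane ((g ^^ r n) p)) \<longlonglongrightarrow> q'"
    unfolding q'_def using lim isCont_tendsto_compose by blast
  then have "eventually (\<lambda>n. from_half_plane ((g ^^ r n) p) \<in> U) sequentially"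
    using U by (auto simp: tendsto_def)
  then obtain n where n: "from_half_plane ((g ^^ r n) p) \<in> U" "from_half_plane ((g ^^ r (Suc n)) p) \<in> U"
    unfolding eventually_sequentially by (metis le_refl le_Suc_eq)
  have less: "r n < r (Suc n)" using r by (simp add: strict_mono_Suc_iff)
  then have "(g ^^ r (Suc n)) p = (g ^^ (r (Suc n) - r n)) ((g ^^ r n) p)"
    by (simp flip: comp_apply [of "g ^^ _" "g ^^ _"] funpow_add)
  then have "(G ^^ (r (Suc n) - r n)) (from_half_plane ((g ^^ r n) p)) \<in> U"
    using n(2) conjn \<open>Im p > 0\<close> by metis
  then show False
    using brouwer_map_free_set_wanders [OF G U(1,2,4) n(1), of "r (Suc n) - r n"] less by simp
qed

section \<open>Symmetric maps\<close>

lemma symmetric_map_axis: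
  assumes "\<And>z. g (cnj z) = cnj (g z)" and up: "\<And>z. Im z > 0 \<Longrightarrow> Im (g z) > 0"
  shows "Im (g z) > 0 \<longleftrightarrow> Im z > 0" "Im (g z) < 0 \<longleftrightarrow> Im z < 0" "Im (g z) = 0 \<longleftrightarrow> Im z = 0"
proof -
  have "Im (g z) < 0" if "Im z < 0"
    using up [of "cnj z"] that assms(1) [of z] by simp
  moreover have "Im (g z) = 0" if "Im z = 0"
  proof -
    have "cnj z = z" using that by (simp add: complex_eq_iff)
    then have "cnj (g z) = g z" using assms(1) [of z] by simp
    then show ?thesis by (simp add: complex_eq_iff)
  qed
  ultimately show "Im (g z) > 0 \<longleftrightarrow> Im z > 0" "Im (g z) < 0 \<longleftrightarrow> Im z < 0"
      "Im (g z) = 0 \<longleftrightarrow> Im z = 0"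
    using up [of z] by linarith+
qed

text \<open>
  A map that preserves the upper and the lower half-plane and reverses the axis is, up to a
  deformation, the reflection \<open>z \<mapsto> - cnj z\<close>, of degree \<open>-1\<close>. Explicitly, the image of \<open>x + \<rho> * cis s\<close>, seen from the
  image of \<open>x\<close>, is never opposite to \<open>- cis (- s)\<close>: both lie in the same open half-plane or on the same ray of the
  axis.
\<close>

lemma symmetric_map_increasing_on_axis:
  assumes g: "continuous_on UNIV g" "inj g" "has_degree g 1"
    and sym: "\<And>z. g (cnj z) = cnj (g z)" and up: "\<And>z. Im z > 0 \<Longrightarrow> Im (g z) > 0"
  shows "strict_mono (\<lambda>t::real. Re (g t))"
proof (rule strict_monoI, rule ccontr)
  fix x y :: real assume xy: "x < y" and "\<not> Re (g x) < Re (g y)"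
  note half = symmetric_map_axis [of g, OF sym up]
  define a where "a = (\<lambda>t::real. Re (g t))"
  have ga: "g t = of_real (a t)" for t :: real
    using half(3) [of t] by (simp add: a_def complex_eq_iff)
  have inja: "inj a"
    using g(2) ga by (metis injD injI of_real_eq_iff)
  have conta: "continuous_on UNIV a"
    unfolding a_def by (intro continuous_intros continuous_on_compose2 [OF g(1)]) auto
  define \<rho> where "\<rho> = y - x"
  have "\<rho> > 0" using xy by (simp add: \<rho>_def)
  then have dec: "a y < a x" "a x < a (x - \<rho>)"
    using continuous_inj_imp_mono [of "x - \<rho>" x y a] xy \<open>\<not> Re (g x) < Re (g y)\<close>
      continuous_on_subset [OF conta] inj_on_subset [OF inja]
    by (auto simp: a_def)
  define Q where "Q = (\<lambda>s. - ((g (x + \<rho> * cis s) - g x) * cis s))"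
  have cont: "continuous_on {0..2*pi} Q"
    unfolding Q_def by (intro continuous_intros continuous_on_compose2 [OF g(1)]) auto
  have neg: "Q s \<notin> \<real>\<^sub>\<le>\<^sub>0" for s
  proof
    assume "Q s \<in> \<real>\<^sub>\<le>\<^sub>0"
    then obtain t' where "t' \<le> 0" "Q s = of_real t'"
      by (auto elim!: nonpos_Reals_cases)
    moreover define t where "t = - t'"
    ultimately have t: "0 \<le> t" "(g (x + \<rho> * cis s) - g x) * cis s = of_real t"
      unfolding Q_def by (simp, metis minus_minus of_real_minus t_def)
    have num: "g (x + \<rho> * cis s) - g x = t * cis (- s)"
    proof -
      have "(g (x + \<rho> * cis s) - g x) * (cis s * cis (- s)) = t * cis (- s)"
        using t(2) by (metis mult.assoc)
      then show ?thesis by (simp add: cis_mult)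
    qed
    have "g (x + \<rho> * cis s) \<noteq> g x"
      using g(2) \<open>\<rho> > 0\<close> by (simp add: inj_eq)
    then have "t > 0" using num t(1) by (cases "t = 0") auto
    have "Im (g (x + \<rho> * cis s)) = - t * sin s"
      using arg_cong [OF num, of Im] by (simp add: ga)
    moreover have "Im (x + \<rho> * cis s) = \<rho> * sin s" by simp
    ultimately have "sin s = 0"
      using half [of "x + \<rho> * cis s"] \<open>t > 0\<close> \<open>\<rho> > 0\<close>
      by (cases "sin s" "0::real" rule: linorder_cases) (auto simp: zero_less_mult_iff mult_less_0_iff)
    then have "cos s = 1 \<or> cos s = - 1"
      using sin_cos_squared_add [of s] by (simp add: power2_eq_1_iff)
    then have "cis s = 1 \<or> cis s = - 1"
      using \<open>sin s = 0\<close> by (simp add: complex_eq_iff)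
    then show False
    proof
      assume "cis s = 1"
      moreover have "cis (- s) = inverse (cis s)" by simp
      ultimately have "g (of_real y) - g x = t" using num by (simp add: \<rho>_def)
      then have "a y - a x = t" using ga by (metis of_real_diff of_real_eq_iff)
      then show False using dec \<open>t > 0\<close> by simp
    next
      assume "cis s = - 1"
      moreover have "cis (- s) = inverse (cis s)" by simp
      ultimately have "g (of_real (x - \<rho>)) - g x = of_real (- t)" using num by simp
      then have "a (x - \<rho>) - a x = - t" using ga by (metis of_real_diff of_real_eq_iff)
      then show False using dec \<open>t > 0\<close> by simp
    qed
  qed
  have e: "exp (of_real (ln \<rho>) + \<i> * s) = \<rho> * cis s" for s :: real
    using \<open>\<rho> > 0\<close> by (simp add: exp_add cis_conv_exp exp_of_real)
  have "g (x + exp (of_real (ln \<rho>) + \<i> * s)) - g x = Q s * exp (\<i> * of_int (- 1) * s + \<i> * pi)" for s :: real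
  proof -
    have "exp (\<i> * of_int (- 1) * s + \<i> * pi) = - cis (- s)"
      by (subst exp_add) (simp add: cis_conv_exp)
    then show ?thesis
      unfolding e by (simp add: Q_def mult.assoc cis_mult)
  qed
  moreover have "Q (2*pi) = Q 0"
    by (simp add: Q_def cis.code)
  ultimately have "(1::int) = - 1"
    by (intro degree_from_quotient [OF g(3) cont _ neg])
  then show False by simp
qed

lemma limit_has_preimage_limit:
  fixes g :: "'a::heine_borel \<Rightarrow> 'a"
  assumes cont: "continuous_on UNIV g" and bd: "bounded (range (\<lambda>n. (g ^^ n) p))"
    and r: "strict_mono r" "(\<lambda>n. (g ^^ r n) p) \<longlonglongrightarrow> q"
  obtains r' q' where "strict_mono r'" "(\<lambda>n. (g ^^ r' n) p) \<longlonglongrightarrow> q'" "g q' = q"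
proof -
  define u where "u = (\<lambda>n. (g ^^ (r (Suc n) - 1)) p)"
  have pos: "r (Suc n) > 0" for n
    using seq_suble [OF r(1), of "Suc n"] by simp
  have "bounded (range u)"
    by (rule bounded_subset [OF bd]) (auto simp: u_def)
  then obtain q' t where t: "strict_mono t" "(u \<circ> t) \<longlonglongrightarrow> q'"
    using bounded_imp_convergent_subsequence by blast
  define r' where "r' = (\<lambda>n. r (Suc (t n)) - 1)"
  have "strict_mono r'"
    unfolding strict_mono_Suc_iff
  proof
    fix n
    have "r (Suc (t n)) < r (Suc (t (Suc n)))"
      using t(1) r(1) by (simp add: strict_mono_less strict_mono_Suc_iff)
    then show "r' n < r' (Suc n)" using pos [of "t n"] by (simp add: r'_def)
  qed
  moreover have lim: "(\<lambda>n. (g ^^ r' n) p) \<longlonglongrightarrow> q'"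
    using t(2) by (simp add: u_def r'_def comp_def)
  moreover have "g q' = q"
  proof -
    have "isCont g q'" using cont by (simp add: continuous_on_eq_continuous_at)
    then have "(\<lambda>n. g ((g ^^ r' n) p)) \<longlonglongrightarrow> g q'"
      using lim isCont_tendsto_compose by blast
    moreover have "g ((g ^^ r' n) p) = (g ^^ r (Suc (t n))) p" for n
      using pos [of "t n"] by (cases "r (Suc (t n))") (auto simp: r'_def)
    moreover have "strict_mono (\<lambda>n. Suc (t n))" using t(1) by (simp add: strict_mono_Suc_iff)
    then have "(\<lambda>n. (g ^^ r (Suc (t n))) p) \<longlonglongrightarrow> q"
      using LIMSEQ_subseq_LIMSEQ [OF r(2)] by (auto simp: comp_def)
    ultimately show ?thesis using LIMSEQ_unique by auto
  qed
  ultimately show ?thesis by (rule that)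
qed

lemma unique_limit_point_imp_convergent:
  fixes s :: "nat \<Rightarrow> 'a::heine_borel"
  assumes bd: "bounded (range s)"
    and uniq: "\<And>r q. strict_mono r \<Longrightarrow> (\<lambda>n. s (r n)) \<longlonglongrightarrow> q \<Longrightarrow> q = l"
  shows "s \<longlonglongrightarrow> l"
proof (rule ccontr)
  assume "\<not> s \<longlonglongrightarrow> l"
  then obtain e where e: "e > 0" "\<And>N. \<exists>n\<ge>N. e \<le> dist (s n) l"
    unfolding lim_sequentially by (meson not_less)
  then have "infinite {n. e \<le> dist (s n) l}"
    unfolding infinite_nat_iff_unbounded_le by simp
  from infinite_enumerate [OF this]
  obtain r :: "nat \<Rightarrow> nat" where r: "strict_mono r" "\<And>n. e \<le> dist (s (r n)) l"
    by auto
  have "bounded (range (s \<circ> r))"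
    by (rule bounded_subset [OF bd]) auto
  then obtain q t where t: "strict_mono t" "(s \<circ> r \<circ> t) \<longlonglongrightarrow> q"
    using bounded_imp_convergent_subsequence by blast
  have "strict_mono (r \<circ> t)" using r t strict_mono_o by blast
  then have "q = l" using uniq [of "r \<circ> t" q] t(2) by (simp add: comp_def)
  then have "(\<lambda>n. dist (s (r (t n))) l) \<longlonglongrightarrow> 0"
    using t(2) tendsto_dist [OF t(2) tendsto_const [of l]] by (simp add: comp_def)
  then have "eventually (\<lambda>n. dist (s (r (t n))) l < e) sequentially"
    using e(1) order_tendstoD(2) by blast
  then show False
    using r(2) by (auto simp: eventually_sequentially not_less [symmetric])
qed

text \<open>
  All limit points are on the axis, by the absence of recurrence. Let \<open>m\<close> be the supremum of the limit points.
  Each of them is the image of one of them, and \<open>a\<close>, the restriction of \<open>g\<close> to the axis, is increasing; so \<open>m \<le> a m\<close>,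
  which is impossible for \<open>m > 0\<close>. The infimum is treated in the same way.
\<close>

theorem symmetric_map_attraction:
  assumes g: "continuous_on UNIV g" "inj g" "has_degree g 1"
    and sym: "\<And>z. g (cnj z) = cnj (g z)" and up: "\<And>z. Im z > 0 \<Longrightarrow> Im (g z) > 0"
    and fixed: "\<And>z. g z = z \<Longrightarrow> z = 0"
    and bd: "\<And>z. bounded (range (\<lambda>n. (g ^^ n) z))"
  shows "(\<lambda>n. (g ^^ n) p) \<longlonglongrightarrow> 0"
proof -
  note half = symmetric_map_axis [of g, OF sym up]
  have half_iter: "Im ((g ^^ n) z) > 0 \<longleftrightarrow> Im z > 0" "Im ((g ^^ n) z) < 0 \<longleftrightarrow> Im z < 0" for n z
    by (induction n) (auto simp: half)
  have sym_iter: "(g ^^ n) (cnj z) = cnj ((g ^^ n) z)" for n z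
    by (induction n) (auto simp: sym)
  define a where "a = (\<lambda>t::real. Re (g t))"
  have ga: "g t = of_real (a t)" for t :: real
    using half(3) [of t] by (simp add: a_def complex_eq_iff)
  have mono: "mono a"
    unfolding a_def by (intro strict_mono_mono symmetric_map_increasing_on_axis g sym up)
  have conta: "continuous_on UNIV a"
    unfolding a_def by (intro continuous_intros continuous_on_compose2 [OF g(1)]) auto
  have iter: "(g ^^ n) (of_real t) = of_real ((a ^^ n) t)" for n t
    by (induction n) (auto simp: ga)

  have axis: "(\<lambda>n. (a ^^ n) t) \<longlonglongrightarrow> 0" for t
  proof -
    have step: "(a ^^ n) x \<le> (a ^^ n) y" if "x \<le> y" for x y n
      using that mono by (induction n) (auto simp: mono_def)
    have "monoseq (\<lambda>n. (a ^^ n) t)"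
      unfolding monoseq_Suc using step [of t "a t"] step [of "a t" t]
      by (cases "t \<le> a t") (auto simp: funpow_swap1)
    moreover have "Bseq (\<lambda>n. (a ^^ n) t)"
    proof -
      obtain b where "\<And>n. norm ((g ^^ n) (of_real t)) \<le> b"
        using bd [of "of_real t"] by (auto simp: bounded_iff)
      then show ?thesis by (intro BseqI' [of _ b]) (simp add: iter)
    qed
    ultimately obtain L where L: "(\<lambda>n. (a ^^ n) t) \<longlonglongrightarrow> L"
      using Bseq_monoseq_convergent convergent_def by blast
    have "isCont a L" using conta by (simp add: continuous_on_eq_continuous_at)
    then have "(\<lambda>n. a ((a ^^ n) t)) \<longlonglongrightarrow> a L"
      using L isCont_tendsto_compose by blast
    moreover have "(\<lambda>n. a ((a ^^ n) t)) \<longlonglongrightarrow> L"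
      using LIMSEQ_Suc [OF L] by simp
    ultimately have "a L = L" using LIMSEQ_unique by blast
    then have "L = 0" using ga [of L] fixed [of "of_real L"] by simp
    then show ?thesis using L by simp
  qed
  have right: "a t < t" if "t > 0" for t
  proof (rule ccontr)
    assume "\<not> a t < t"
    then have "t \<le> a t" by simp
    then have "incseq (\<lambda>n. (a ^^ n) t)"
    proof -
      have "(a ^^ n) t \<le> (a ^^ Suc n) t" for n
        using \<open>t \<le> a t\<close> mono by (induction n) (auto simp: mono_def)
      then show ?thesis by (rule incseq_SucI)
    qed
    then have "(a ^^ 0) t \<le> 0" using incseq_le axis by blast
    then show False using that by simp
  qed
  have left: "t < a t" if "t < 0" for t
  proof (rule ccontr)
    assume "\<not> t < a t"
    then have "a t \<le> t" by simp
    then have "decseq (\<lambda>n. (a ^^ n) t)"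
    proof -
      have "(a ^^ Suc n) t \<le> (a ^^ n) t" for n
        using \<open>a t \<le> t\<close> mono by (induction n) (auto simp: mono_def)
      then show ?thesis by (rule decseq_SucI)
    qed
    then have "0 \<le> (a ^^ 0) t" using decseq_ge axis by blast
    then show False using that by simp
  qed

  define W where "W = {q. \<exists>r. strict_mono r \<and> (\<lambda>n. (g ^^ r n) p) \<longlonglongrightarrow> q}"
  have nofix: "g z \<noteq> z" if "Im z > 0" for z
    using fixed that by fastforce
  have wander: "\<not> Im q > 0"
    if "Im p > 0" "strict_mono r" "(\<lambda>n. (g ^^ r n) p) \<longlonglongrightarrow> q" for p q r
    using half_plane_no_recurrence [OF g _ _ that(1) _ that(2,3)] up nofix by metis
  have real: "Im q = 0" if q: "q \<in> W" for q
  proof -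
    obtain r where r: "strict_mono r" "(\<lambda>n. (g ^^ r n) p) \<longlonglongrightarrow> q"
      using q by (auto simp: W_def)
    have im: "(\<lambda>n. Im ((g ^^ r n) p)) \<longlonglongrightarrow> Im q"
      using r(2) by (rule tendsto_Im)
    consider "Im p > 0" | "Im p = 0" | "Im p < 0" by linarith
    then show ?thesis
    proof cases
      case 1
      then have "Im q \<ge> 0"
        by (intro LIMSEQ_le_const [OF im]) (metis half_iter(1) less_imp_le)
      moreover have "\<not> Im q > 0"
        using wander [OF 1 r] .
      ultimately show ?thesis by simp
    next
      case 2
      then have "Im ((g ^^ n) p) = 0" for n
        using half_iter [of n p] by linarith
      then show ?thesis using im by (simp add: LIMSEQ_const_iff)
    next
      case 3
      then have "Im q \<le> 0"
        by (intro LIMSEQ_le_const2 [OF im]) (metis half_iter(2) less_imp_le)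
      have "(\<lambda>n. (g ^^ r n) (cnj p)) \<longlonglongrightarrow> cnj q"
        unfolding sym_iter using r(2) by (rule tendsto_cnj)
      moreover have "Im (cnj p) > 0"
        using 3 by simp
      ultimately have "\<not> Im (cnj q) > 0"
        using wander r(1) by metis
      with \<open>Im q \<le> 0\<close> show ?thesis by simp
    qed
  qed
  have pre: "\<exists>q'\<in>W. g q' = q" if "q \<in> W" for q
    using that limit_has_preimage_limit [OF g(1) bd] unfolding W_def by blast
  have pre': "\<exists>q'\<in>W. Re q = a (Re q')" if q: "q \<in> W" for q
  proof -
    obtain q' where q': "q' \<in> W" "g q' = q" using pre [OF q] by blast
    then have "q' = of_real (Re q')" using real by (simp add: complex_eq_iff)
    then show ?thesis using q' unfolding a_def by metis
  qed
  have "W \<subseteq> closure (range (\<lambda>n. (g ^^ n) p))"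
  proof
    fix q assume "q \<in> W"
    then obtain r where "(\<lambda>n. (g ^^ r n) p) \<longlonglongrightarrow> q" by (auto simp: W_def)
    then show "q \<in> closure (range (\<lambda>n. (g ^^ n) p))"
      unfolding closure_sequential by (intro exI [of _ "\<lambda>n. (g ^^ r n) p"]) auto
  qed
  then have "bounded W"
    using bd bounded_closure bounded_subset by blast
  then obtain b where b: "\<And>q. q \<in> W \<Longrightarrow> \<bar>Re q\<bar> \<le> b"
    by (metis abs_Re_le_cmod bounded_iff order_trans)
  have bdd: "bdd_above (Re ` W)" "bdd_below (Re ` W)"
    using b by (auto intro!: bdd_aboveI2 [of _ _ b] bdd_belowI2 [of _ "- b"] simp: abs_le_iff minus_le_iff)
  have "q = 0" if q: "q \<in> W" for q
  proof -
    have "Sup (Re ` W) \<le> a (Sup (Re ` W))"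
    proof (rule cSUP_least)
      fix z assume "z \<in> W"
      then obtain z' where z': "z' \<in> W" "Re z = a (Re z')" using pre' by blast
      then have "Re z' \<le> Sup (Re ` W)" using bdd by (intro cSUP_upper)
      then show "Re z \<le> a (Sup (Re ` W))" using mono z'(2) by (simp add: mono_def)
    qed (use q in blast)
    then have "Sup (Re ` W) \<le> 0" using right by (meson not_less)
    moreover have "a (Inf (Re ` W)) \<le> Inf (Re ` W)"
    proof (rule cINF_greatest)
      fix z assume "z \<in> W"
      then obtain z' where z': "z' \<in> W" "Re z = a (Re z')" using pre' by blast
      then have "Inf (Re ` W) \<le> Re z'" using bdd by (intro cINF_lower)
      then show "a (Inf (Re ` W)) \<le> Re z" using mono z'(2) by (simp add: mono_def)
    qed (use q in blast)
    then have "0 \<le> Inf (Re ` W)" using left by (meson not_less)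
    moreover have "Re q \<le> Sup (Re ` W)" "Inf (Re ` W) \<le> Re q"
      using q bdd by (auto intro: cSUP_upper cINF_lower)
    ultimately have "Re q = 0" by linarith
    then show ?thesis using real [OF q] by (simp add: complex_eq_iff)
  qed
  then show ?thesis
    using bd by (intro unique_limit_point_imp_convergent) (auto simp: W_def)
qed

section \<open>From the real plane to the complex plane\<close>

lemma plane_complex_inverse [simp]:
  "plane_to_complex (complex_to_plane z) = z" "complex_to_plane (plane_to_complex v) = v"
  by (simp_all add: plane_to_complex_def complex_to_plane_def vec_eq_iff forall_2)

lemma continuous_plane_to_complex: "continuous_on S plane_to_complex"
  unfolding plane_to_complex_def Complex_eq by (intro continuous_intros)

lemma continuous_complex_to_plane: "continuous_on S complex_to_plane"
proof -
  have eq: "complex_to_plane z = Re z *\<^sub>R axis 1 1 + Im z *\<^sub>R axis 2 1" for z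
    by (simp add: complex_to_plane_def vec_eq_iff forall_2 axis_def)
  have "continuous_on S (\<lambda>z. Re z *\<^sub>R axis 1 1 + Im z *\<^sub>R axis 2 1 :: plane)"
    by (intro continuous_intros)
  then show ?thesis
    unfolding eq [abs_def] by simp
qed

lemma flip_mult: "flip *v v = vector [v $ 1, - v $ 2]"
  by (simp add: flip_def matrix_vector_mult_def vec_eq_iff forall_2 sum_2)

definition complex_form :: "(plane \<Rightarrow> plane) \<Rightarrow> complex \<Rightarrow> complex" where
  "complex_form f = plane_to_complex \<circ> f \<circ> complex_to_plane"

lemma complex_form_funpow:
  "(complex_form f ^^ n) z = plane_to_complex ((f ^^ n) (complex_to_plane z))"
  by (induction n) (auto simp: complex_form_def)

lemma complex_form_Emb:
  assumes "f \<in> Emb"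
  shows "continuous_on UNIV (complex_form f)" "inj (complex_form f)"
proof -
  have f: "continuous_on UNIV f" "inj f" using assms by (auto simp: Emb_def)
  show "continuous_on UNIV (complex_form f)"
    unfolding complex_form_def
    by (intro continuous_on_compose continuous_complex_to_plane continuous_plane_to_complex
        continuous_on_subset [OF f(1)]) auto
  show "inj (complex_form f)"
    unfolding complex_form_def
    by (intro inj_compose f(2) inj_on_inverseI [of _ complex_to_plane]
        inj_on_inverseI [of _ plane_to_complex]) simp_all
qed

text \<open>
  The bridge between the degree and winding numbers, in terms of which orientation is expressed.
\<close>

lemma winding_number_circle_image:
  assumes deg: "has_degree F d" and F: "continuous_on UNIV F" "inj F"
  shows "winding_number (F \<circ> circlepath z 1) (F z) = d"
proof -
  have path: "path (F \<circ> circlepath z 1)"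
    by (intro path_continuous_image continuous_on_subset [OF F(1)]) auto
  have off: "F z \<notin> path_image (F \<circ> circlepath z 1)"
    using F(2) by (auto simp: path_image_compose inj_eq)
  obtain q where q: "path q"
      "pathfinish q - pathstart q = 2 * of_real pi * \<i> * winding_number (F \<circ> circlepath z 1) (F z)"
      "\<And>t. t \<in> {0..1} \<Longrightarrow> (F \<circ> circlepath z 1) t = F z + exp (q t)"
    using winding_number_as_continuous_log [OF path off] by blast
  define N where "N = (\<lambda>s. q (s / (2 * pi)))"
  have "N (2 * pi) - N 0 = 2 * pi * \<i> * d"
  proof (rule degree_from_circle [OF deg])
    have "continuous_on {0..1} q" using q(1) by (simp add: path_def)
    then show "continuous_on {0..2*pi} N"
      unfolding N_def by (rule continuous_on_compose2) (auto intro!: continuous_intros simp: field_simps)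
    fix s :: real assume "s \<in> {0..2*pi}"
    then have "s / (2 * pi) \<in> {0..1}" by (simp add: field_simps)
    from q(3) [OF this] show "F (z + exp (0 + \<i> * s)) - F z = exp (N s)"
      by (simp add: circlepath N_def)
  qed
  then show ?thesis
    using q(2) by (simp add: N_def pathfinish_def pathstart_def)
qed

text \<open>
  The image of a circle is a Jordan curve, whose winding numbers are among \<open>-1\<close>, \<open>0\<close>, \<open>1\<close>; and the
  degree is odd. Hence the square of every embedding preserves orientation.
\<close>

lemma degree_is_unit:
  assumes deg: "has_degree F d" and F: "continuous_on UNIV F" "inj F"
  shows "d * d = 1"
proof -
  have "simple_path (F \<circ> circlepath 0 1)"
    by (intro simple_path_continuous_image continuous_on_subset [OF F(1)] inj_on_subset [OF F(2)]
        simple_path_circlepath [THEN iffD2]) auto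
  moreover have "pathfinish (F \<circ> circlepath 0 1) = pathstart (F \<circ> circlepath 0 1)"
    by (simp add: pathfinish_compose pathstart_compose)
  moreover have "F 0 \<notin> path_image (F \<circ> circlepath 0 1)"
    using F(2) by (auto simp: path_image_compose inj_eq)
  ultimately have "winding_number (F \<circ> circlepath 0 1) (F 0) \<in> {-1, 0, 1}"
    by (rule simple_closed_path_winding_number_cases)
  then have "(of_int d :: complex) \<in> {of_int (-1), of_int 0, of_int 1}"
    using winding_number_circle_image [OF assms] by simp
  then have "d \<in> {-1, 0, 1}"
    by (simp only: insert_iff of_int_eq_iff empty_iff)
  moreover have "d \<noteq> 0" using degree_odd [OF deg] by auto
  ultimately show ?thesis by auto
qed

lemma Emb_plus_degree:
  assumes "f \<in> Emb_plus"
  shows "has_degree (complex_form f) 1"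
proof -
  have f: "f \<in> Emb" "orientation_preserving f" using assms by (auto simp: Emb_plus_def)
  note F = complex_form_Emb [OF f(1)]
  obtain d where d: "has_degree (complex_form f) d"
    using degree_exists [OF F] .
  have "winding_number (complex_form f \<circ> circlepath 0 1) (complex_form f 0) = 1"
    using f(2) unfolding orientation_preserving_def complex_form_def
    by (metis comp_apply plane_complex_inverse(1) zero_less_one)
  then have "d = 1"
    using winding_number_circle_image [OF d F] by simp
  then show ?thesis using d by simp
qed

section \<open>Symmetry, half-planes and dissipation\<close>

lemma subgroup_symmetries: "subgroup (symmetries f) GL2"
proof (rule group.subgroupI [OF group_GL2])
  show "symmetries f \<subseteq> carrier GL2" by (auto simp: symmetries_def)
  have "mat 1 \<in> symmetries f"
    using group.is_monoid [OF group_GL2] monoid.one_closed [of GL2]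
    by (auto simp: symmetries_def GL2_def)
  then show "symmetries f \<noteq> {}" by blast
  show "a \<otimes>\<^bsub>GL2\<^esub> b \<in> symmetries f" if "a \<in> symmetries f" "b \<in> symmetries f" for a b
    using that by (auto simp: symmetries_def GL2_def invertible_mult simp flip: matrix_vector_mul_assoc)
  show "inv\<^bsub>GL2\<^esub> a \<in> symmetries f" if a: "a \<in> symmetries f" for a
  proof -
    have carr: "a \<in> carrier GL2" using a by (simp add: symmetries_def)
    define b where "b = inv\<^bsub>GL2\<^esub> a"
    have b: "b \<in> carrier GL2"
      unfolding b_def using group.inv_closed [OF group_GL2 carr] .
    have ab: "a ** b = mat 1" "b ** a = mat 1"
      using group.r_inv [OF group_GL2 carr] group.l_inv [OF group_GL2 carr]
      by (simp_all add: b_def GL2_def)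
    have "f (b *v x) = b *v f x" for x
    proof -
      have "a *v f (b *v x) = f (a *v (b *v x))"
        using a by (simp add: symmetries_def)
      also have "\<dots> = f x" by (simp add: matrix_vector_mul_assoc ab)
      finally have "b *v (a *v f (b *v x)) = b *v f x" by simp
      then show ?thesis by (simp add: matrix_vector_mul_assoc ab)
    qed
    then show ?thesis using b by (simp add: symmetries_def b_def)
  qed
qed

lemma closedin_symmetries:
  assumes "continuous_on UNIV f"
  shows "closedin (top_of_set (carrier GL2)) (symmetries f)"
proof -
  have lin: "continuous_on UNIV (\<lambda>\<gamma>::real^2^2. \<gamma> *v x)" for x
    unfolding matrix_vector_mult_def
    by (intro continuous_on_vec_lambda continuous_intros)
  have "closed {\<gamma>. \<forall>x. f (\<gamma> *v x) = \<gamma> *v f x}"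
    by (intro closed_Collect_all closed_Collect_eq lin continuous_on_compose2 [OF assms lin]) auto
  moreover have "symmetries f = carrier GL2 \<inter> {\<gamma>. \<forall>x. f (\<gamma> *v x) = \<gamma> *v f x}"
    by (auto simp: symmetries_def)
  ultimately show ?thesis
    by (auto simp: closedin_closed)
qed

text \<open>
  The symmetries of a continuous map already form a closed subgroup, so no element is added by
  passing to the closed subgroup that they generate.
\<close>

lemma symmetry_group_eq_symmetries:
  assumes "continuous_on UNIV f"
  shows "symmetry_group f = symmetries f"
  unfolding symmetry_group_def
  using subgroup_symmetries closedin_symmetries [OF assms] by (intro antisym Inter_lower Inter_greatest) auto

lemma complex_form_cnj:
  assumes "flip \<in> symmetries f"
  shows "complex_form f (cnj z) = cnj (complex_form f z)"
proof -
  have "complex_to_plane (cnj z) = flip *v complex_to_plane z"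
    by (simp add: complex_to_plane_def flip_mult)
  moreover have "plane_to_complex (flip *v v) = cnj (plane_to_complex v)" for v
    by (simp add: flip_mult plane_to_complex_def complex_eq_iff)
  ultimately show ?thesis
    using assms by (simp add: complex_form_def symmetries_def)
qed

lemma upper_half_plane_component:
  "{p::plane. p $ 2 > 0} \<in> components (UNIV - fixed_points ((*v) flip))"
proof -
  have axis: "fixed_points ((*v) flip) = {p. p $ 2 = 0}"
    by (auto simp: fixed_points_def flip_mult vec_eq_iff forall_2)
  have "convex {p::plane. p $ 2 > 0}"
  proof -
    have "{p::plane. p $ 2 > 0} = {p. axis 2 1 \<bullet> p > 0}"
      by (simp add: inner_axis' )
    then show ?thesis by (simp add: convex_halfspace_gt)
  qed
  moreover have "D = {p. p $ 2 > 0}"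
    if D: "{p::plane. p $ 2 > 0} \<subseteq> D" "D \<subseteq> {p. p $ 2 \<noteq> 0}" "connected D" for D
  proof (rule ccontr)
    assume "D \<noteq> {p. p $ 2 > 0}"
    then obtain u where u: "u \<in> D" "u $ 2 \<le> 0"
      using D(1) by force
    have "vector [0, 1] \<in> D" using D(1) by auto
    then have "\<exists>z\<in>D. z $ 2 = 0"
      using connected_ivt_component_cart [OF D(3) u(1), of "vector [0, 1]" 2 0] u(2) by simp
    then show False using D(2) by blast
  qed
  moreover have "vector [0, 1] \<in> {p::plane. p $ 2 > 0}" by simp
  then have "{p::plane. p $ 2 > 0} \<noteq> {}" by blast
  moreover have "{p::plane. p $ 2 > 0} \<subseteq> UNIV - {p. p $ 2 = 0}" by auto
  moreover have "UNIV - {p::plane. p $ 2 = 0} = {p. p $ 2 \<noteq> 0}" by auto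
  ultimately show ?thesis
    unfolding in_components_maximal axis by (simp add: convex_connected)
qed

lemma complex_form_upper_half_plane:
  assumes "not_interchanging_components f" "Im z > 0"
  shows "Im (complex_form f z) > 0"
proof -
  have "f ` {p. p $ 2 > 0} \<subseteq> {p. p $ 2 > 0}"
    using assms(1) upper_half_plane_component by (simp add: not_interchanging_components_def)
  moreover have "complex_to_plane z \<in> {p. p $ 2 > 0}"
    using assms(2) by (simp add: complex_to_plane_def)
  ultimately show ?thesis
    by (auto simp: complex_form_def plane_to_complex_def)
qed

text \<open>
  By symmetry and injectivity only points of the axis are mapped to the axis, so the connected upper half-plane
  is mapped into one of the two half-planes; if it is the lower one, then by symmetry the lower one is mapped
  into the upper one.
\<close>

lemma symmetric_square_preserves_upper_half_plane:
  assumes F: "continuous_on UNIV F" "inj F" and sym: "\<And>z. F (cnj z) = cnj (F z)" and z: "Im z > 0"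
  shows "Im (F (F z)) > 0"
proof -
  have off: "Im (F w) \<noteq> 0" if "Im w > 0" for w
  proof
    assume "Im (F w) = 0"
    then have "F (cnj w) = F w" by (simp add: sym complex_eq_iff)
    then have "cnj w = w" using F(2) by (simp add: inj_eq)
    then show False using that by (simp add: complex_eq_iff)
  qed
  have conn: "connected (F ` {w. Im w > 0})"
    by (intro connected_continuous_image continuous_on_subset [OF F(1)] convex_connected
        convex_halfspace_Im_gt) auto
  have same: "Im (F w) > 0 \<longleftrightarrow> Im (F u) > 0" if "Im w > 0" "Im u > 0" for w u
  proof -
    have "False" if wu: "Im w > 0" "Im u > 0" "Im (F w) > 0" "Im (F u) < 0" for w u
    proof -
      have "\<exists>v\<in>F ` {w. Im w > 0}. \<i> \<bullet> v = 0"
        by (rule connected_ivt_hyperplane [OF conn, of "F u" "F w"]) (use wu in auto)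
      then show False using off by auto
    qed
    then show ?thesis using that off by (metis linorder_neqE_linordered_idom)
  qed
  show ?thesis
  proof (cases "Im (F z) > 0")
    case True
    then show ?thesis using same z by blast
  next
    case False
    then have "Im (cnj (F z)) > 0" using off [OF z] by simp
    then have "\<not> Im (F (cnj (F z))) > 0" using same z False by blast
    then show ?thesis
      using off [OF \<open>Im (cnj (F z)) > 0\<close>] by (simp add: sym)
  qed
qed

text \<open>
  An unbounded orbit that does not tend to infinity would leave a large closed ball \<open>C\<close> infinitely often. The
  points from which it leaves accumulate at some \<open>q\<close> in \<open>C\<close>, and then \<open>f q\<close> is a limit point outside the
  interior of \<open>C\<close>, hence in \<open>V\<close>.
\<close>

lemma dissipative_imp_bounded_orbit:
  assumes cont: "continuous_on UNIV f" and "dissipative f"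
  shows "bounded (range (\<lambda>n. (f ^^ n) p))"
proof (rule ccontr)
  define s where "s = (\<lambda>n. (f ^^ n) p)"
  assume "\<not> bounded (range (\<lambda>n. (f ^^ n) p))"
  then have unb: "\<not> bounded (range s)" by (simp add: s_def)
  obtain V where V: "compact (UNIV - V)" "omega_limit f p \<inter> V = {}" "\<not> omega_is_infinity f p"
    using assms(2) unfolding dissipative_def by metis
  obtain R where R: "UNIV - V \<subseteq> ball 0 R"
    using bounded_subset_ballD [OF compact_imp_bounded [OF V(1)]] by blast
  obtain Z where Z: "\<And>N. \<exists>n\<ge>N. norm (s n) < Z"
    using V(3) unfolding omega_is_infinity_def s_def filterlim_at_top eventually_sequentially
    by (meson not_less)
  define C where "C = cball (0::plane) (max R Z)"
  have "\<exists>j\<ge>N. s j \<in> C \<and> s (Suc j) \<notin> C" for N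
  proof (rule ccontr)
    assume "\<not> ?thesis"
    then have stay: "s (Suc j) \<in> C" if "N \<le> j" "s j \<in> C" for j using that by blast
    obtain n where n: "n \<ge> N" "norm (s n) < Z" using Z by blast
    have later: "s (n + j) \<in> C" for j
      by (induction j) (use n stay in \<open>auto simp: C_def\<close>)
    have "range s \<subseteq> s ` {..n} \<union> C"
    proof
      fix w assume "w \<in> range s"
      then obtain m where m: "w = s m" by blast
      show "w \<in> s ` {..n} \<union> C"
      proof (cases "m \<le> n")
        case False
        then have "w = s (n + (m - n))" by (simp add: m)
        then show ?thesis using later [of "m - n"] by simp
      qed (simp add: m)
    qed
    moreover have "bounded (s ` {..n} \<union> C)"
      by (simp add: C_def finite_imp_bounded)
    ultimately show False using unb bounded_subset by blast
  qed
  then have "infinite {j. s j \<in> C \<and> s (Suc j) \<notin> C}"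
    unfolding infinite_nat_iff_unbounded_le by simp
  from infinite_enumerate [OF this]
  obtain r :: "nat \<Rightarrow> nat" where r: "strict_mono r" "\<And>n. s (r n) \<in> C" "\<And>n. s (Suc (r n)) \<notin> C"
    by auto
  have "bounded (range (s \<circ> r))"
    by (rule bounded_subset [of C]) (use r(2) in \<open>auto simp: C_def\<close>)
  then obtain q t where t: "strict_mono t" "(s \<circ> r \<circ> t) \<longlonglongrightarrow> q"
    using bounded_imp_convergent_subsequence by blast
  have "isCont f q" using cont by (simp add: continuous_on_eq_continuous_at)
  then have "(\<lambda>n. f (s (r (t n)))) \<longlonglongrightarrow> f q"
    using isCont_tendsto_compose t(2) by (fastforce simp: comp_def)
  then have lim: "(\<lambda>n. s (Suc (r (t n)))) \<longlonglongrightarrow> f q"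
    by (simp add: s_def)
  moreover have "filterlim (\<lambda>n. Suc (r (t n))) at_top sequentially"
    using r(1) t(1) by (intro filterlim_subseq) (simp add: strict_mono_def)
  ultimately have "f q \<in> omega_limit f p"
    unfolding omega_limit_def s_def mem_Collect_eq by (intro exI [of _ "\<lambda>n. Suc (r (t n))"] conjI)
  then have "f q \<in> ball 0 R" using V(2) R by blast
  then have "eventually (\<lambda>n. s (Suc (r (t n))) \<in> ball 0 R) sequentially"
    using lim by (metis open_ball topological_tendstoD)
  then obtain N where "s (Suc (r (t N))) \<in> ball 0 R"
    by (auto simp: eventually_sequentially)
  then show False
    using r(3) [of "t N"] by (simp add: C_def)
qed

lemma zero_global_attractor_if_convergent:
  assumes "f 0 = 0" "\<And>p. (\<lambda>n. (f ^^ n) p) \<longlonglongrightarrow> 0"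
  shows "zero_global_attractor f"
  unfolding zero_global_attractor_def
proof (intro conjI allI)
  show "0 \<in> fixed_points f" using assms(1) by (simp add: fixed_points_def)
  fix p
  have "q = 0" if "filterlim n at_top sequentially" "(\<lambda>j. (f ^^ n j) p) \<longlonglongrightarrow> q" for n q
    using filterlim_compose [OF assms(2) that(1)] that(2) LIMSEQ_unique by blast
  moreover have "0 \<in> omega_limit f p"
    unfolding omega_limit_def using assms(2) filterlim_ident by blast
  ultimately show "omega_limit f p = {0}"
    by (auto simp: omega_limit_def)
qed

lemma convergent_if_square_convergent:
  fixes F :: "'a::real_normed_vector \<Rightarrow> 'a"
  assumes cont: "continuous_on UNIV F" and "F 0 = 0"
    and lim: "(\<lambda>n. ((F \<circ> F) ^^ n) z) \<longlonglongrightarrow> 0"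
  shows "(\<lambda>n. (F ^^ n) z) \<longlonglongrightarrow> 0"
proof -
  have sq: "((F \<circ> F) ^^ n) z = (F ^^ (2 * n)) z" for n
    by (induction n) auto
  have even: "(\<lambda>n. (F ^^ (2 * n)) z) \<longlonglongrightarrow> 0"
    using lim by (simp add: sq)
  moreover have "isCont F 0" using cont by (simp add: continuous_on_eq_continuous_at)
  ultimately have "(\<lambda>n. F ((F ^^ (2 * n)) z)) \<longlonglongrightarrow> F 0"
    using isCont_tendsto_compose by blast
  then have odd: "(\<lambda>n. (F ^^ Suc (2 * n)) z) \<longlonglongrightarrow> 0"
    by (simp add: assms(2))
  show ?thesis
    unfolding lim_sequentially
  proof (intro allI impI)
    fix e :: real assume "e > 0"
    then obtain N M where "\<And>n. n \<ge> N \<Longrightarrow> dist ((F ^^ (2 * n)) z) 0 < e"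
        and "\<And>n. n \<ge> M \<Longrightarrow> dist ((F ^^ Suc (2 * n)) z) 0 < e"
      using even odd unfolding lim_sequentially by meson
    moreover have "n = 2 * (n div 2) \<or> n = Suc (2 * (n div 2))" for n :: nat by presburger
    moreover have "n div 2 \<ge> N \<and> n div 2 \<ge> M" if "n \<ge> 2 * (N + M)" for n
      using that by presburger
    ultimately show "\<exists>K. \<forall>n\<ge>K. dist ((F ^^ n) z) 0 < e"
      by metis
  qed
qed

section \<open>Global attraction\<close>

theorem theorem3p6:
  fixes f :: "real^2 \<Rightarrow> real^2" and \<Gamma> :: "(real^2^2) set"
  assumes "f \<in> Emb"
    and "dissipative f"
    and "\<Gamma> = symmetry_group f"
    and "compact \<Gamma>"
    and "flip \<in> \<Gamma>"
    and "fixed_points f = {0}"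
    and "(f \<in> Emb_plus \<and> not_interchanging_components f) \<or> (\<nexists>Q. two_periodic_orbit f Q)"
  shows "zero_global_attractor f"
proof -
  have cont: "continuous_on UNIV f" using assms(1) by (simp add: Emb_def)
  define F where "F = complex_form f"
  have F: "continuous_on UNIV F" "inj F"
    using complex_form_Emb [OF assms(1)] by (simp_all add: F_def)
  have zero: "plane_to_complex 0 = 0" "complex_to_plane 0 = 0"
    by (simp_all add: plane_to_complex_def complex_to_plane_def complex_eq_iff vec_eq_iff forall_2)
  have fix_f: "f v = v \<longleftrightarrow> v = 0" for v
    using assms(6) by (auto simp: fixed_points_def)
  have F0: "F 0 = 0"
    using fix_f [of 0] by (simp add: F_def complex_form_def zero)
  have fixed: "z = 0" if "F z = z" for z
    using that fix_f [of "complex_to_plane z"] zero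
    unfolding F_def complex_form_def comp_apply by (metis plane_complex_inverse)
  have sym: "F (cnj z) = cnj (F z)" for z
    using assms(3,5) complex_form_cnj symmetry_group_eq_symmetries [OF cont] by (simp add: F_def)
  have iter: "(F ^^ n) z = plane_to_complex ((f ^^ n) (complex_to_plane z))" for n z
    by (simp add: F_def complex_form_funpow)
  have bd: "bounded (range (\<lambda>n. (F ^^ n) z))" for z
  proof -
    have "compact (plane_to_complex ` closure (range (\<lambda>n. (f ^^ n) (complex_to_plane z))))"
      using dissipative_imp_bounded_orbit [OF cont assms(2)]
      by (intro compact_continuous_image continuous_plane_to_complex) (simp add: compact_closure)
    then show ?thesis
      by (rule bounded_subset [OF compact_imp_bounded]) (use closure_subset in \<open>fastforce simp: iter\<close>)
  qed
  have lim: "(\<lambda>n. (F ^^ n) z) \<longlonglongrightarrow> 0" for z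
    using assms(7)
  proof
    assume a: "f \<in> Emb_plus \<and> not_interchanging_components f"
    have "has_degree F 1"
      using a Emb_plus_degree by (simp add: F_def)
    moreover have "Im (F z) > 0" if "Im z > 0" for z
      using a complex_form_upper_half_plane that by (simp add: F_def)
    ultimately show ?thesis
      using symmetric_map_attraction [OF F _ sym _ fixed bd] by blast
  next
    assume b: "\<nexists>Q. two_periodic_orbit f Q"
    obtain d where d: "has_degree F d" using degree_exists [OF F] .
    have "has_degree (F \<circ> F) 1"
      using degree_compose [OF d d F(1)] degree_is_unit [OF d F] by simp
    moreover have "continuous_on UNIV (F \<circ> F)" "inj (F \<circ> F)"
      using continuous_on_compose [OF F(1) continuous_on_subset [OF F(1)]] inj_compose [OF F(2) F(2)]
      by auto
    moreover have "(F \<circ> F) (cnj z) = cnj ((F \<circ> F) z)" for z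
      by (simp add: sym)
    moreover have "Im ((F \<circ> F) z) > 0" if "Im z > 0" for z
      using symmetric_square_preserves_upper_half_plane [OF F sym that] by simp
    moreover have "z = 0" if "(F \<circ> F) z = z" for z
    proof -
      define v where "v = complex_to_plane z"
      have "(f ^^ 2) v = v"
        using arg_cong [OF that, of complex_to_plane]
        by (simp add: F_def complex_form_def v_def numeral_2_eq_2)
      then have "f v = v"
        using b unfolding two_periodic_orbit_def by blast
      then have "F z = z" by (simp add: F_def complex_form_def v_def)
      then show ?thesis by (rule fixed)
    qed
    moreover have "bounded (range (\<lambda>n. ((F \<circ> F) ^^ n) z))" for z
    proof (rule bounded_subset [OF bd [of z]])
      have "((F \<circ> F) ^^ n) z = (F ^^ (2 * n)) z" for n
        by (induction n) auto
      then show "range (\<lambda>n. ((F \<circ> F) ^^ n) z) \<subseteq> range (\<lambda>n. (F ^^ n) z)" by auto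
    qed
    ultimately have "(\<lambda>n. ((F \<circ> F) ^^ n) z) \<longlonglongrightarrow> 0"
      by (intro symmetric_map_attraction)
    then show ?thesis
      by (rule convergent_if_square_convergent [OF F(1) F0])
  qed
  show ?thesis
  proof (rule zero_global_attractor_if_convergent)
    show "f 0 = 0" using fix_f by simp
    fix p
    have "isCont complex_to_plane 0"
      using continuous_complex_to_plane [of UNIV] by (simp add: continuous_on_eq_continuous_at)
    then have "(\<lambda>n. complex_to_plane ((F ^^ n) (plane_to_complex p))) \<longlonglongrightarrow> complex_to_plane 0"
      using lim isCont_tendsto_compose by blast
    then show "(\<lambda>n. (f ^^ n) p) \<longlonglongrightarrow> 0"
      by (simp add: iter zero)
  qed
qed

end
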